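(* Let $d\ge 2$ and let $n_1<\cdots<n_d$ be positive integers. Put $m_i=n_d-n_i$ for $1\le i\le d$, $g=\gcd(m_1,\ldots,m_{d-1})$, let $T$ be the numerical semigroup generated by $\frac{m_1}{g},\ldots,\frac{m_{d-1}}{g}$, let $c$ be the conductor of $T$, and let $$L=m_1m_2\left(\frac{gc+m_1}{m_{d-1}}+d\right)-n_d .$$ For a non-negative integer $j$ let $S+j=\langle n_1+j,\ldots,n_d+j\rangle$. If $j>L$, then $S+j$ is homogeneous and $G(S+j)$ is Cohen-Macaulay.
   Context: The conductor of a numerical semigroup $T$ is the least $c\in T$ such that $c+i\in T$ for all $i>0$. $\langle\cdot\rangle$ denotes the submonoid of $(\mathbb N,+)$ generated by the given elements (its generators need not have gcd 1). For such a semigroup $H$ with minimal generators $h_1<\cdots<h_r$, put $\mathrm{AP}(H,h_1)=\{x\in H: x-h_1\notin H\}$; $H$ is homogeneous if for each $0\ne s\in \mathrm{AP}(H,h_1)$ all $\mathbf a\in\mathbb N^r$ with $\sum a_ih_i=s$ have the same $\sum_i a_i$. $G(H)$ (tangent cone) is the associated graded ring of $\Bbbk[H]=\Bbbk[t^{h_1},\ldots,t^{h_r}]$ ($\Bbbk$ a field) with respect to the ideal $(t^{h_1},\ldots,t^{h_r})$. *)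

theory Defs
  imports
    "HOL-Library.Extended_Nat"
    "HOL-Computational_Algebra.Polynomial"
    "HOL-Algebra.QuotRing"
    "HOL-Algebra.Ideal_Product"
    "HOL-Algebra.Generated_Rings"
    "HOL-Algebra.Ring_Divisibility"
    "HOL-Algebra.Algebraic_Closure_Type"
begin

section \<open>Submonoids of the natural numbers\<close>

inductive_set submonoid_gen :: "nat set \<Rightarrow> nat set" for A where
  zero: "0 \<in> submonoid_gen A"
| add: "a \<in> A \<Longrightarrow> x \<in> submonoid_gen A \<Longrightarrow> a + x \<in> submonoid_gen A"

definition conductor :: "nat set \<Rightarrow> nat" where
  "conductor T = (LEAST c. c \<in> T \<and> (\<forall>i>0. c + i \<in> T))"

definition minimal_generators :: "nat set \<Rightarrow> nat set \<Rightarrow> bool" where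
  "minimal_generators A H \<longleftrightarrow>
     submonoid_gen A = H \<and> (\<forall>B. B \<subset> A \<longrightarrow> submonoid_gen B \<noteq> H)"

text \<open>Every submonoid of the natural numbers has exactly one minimal generating set; see
  \<open>min_gens_minimal_generators\<close> and \<open>minimal_generators_unique\<close> below.\<close>

definition min_gens :: "nat set \<Rightarrow> nat set" where
  "min_gens H = (THE A. minimal_generators A H)"

definition multiplicity_of :: "nat set \<Rightarrow> nat" where
  "multiplicity_of H = Min (min_gens H)"

text \<open>The condition \<open>x - h \<notin> H\<close> refers to integer subtraction, so it holds whenever \<open>x < h\<close>.\<close>

definition apery :: "nat set \<Rightarrow> nat \<Rightarrow> nat set" where
  "apery H h = {x \<in> H. \<not> (\<exists>y\<in>H. x = y + h)}"

text \<open>A coefficient vector is indexed by the minimal generators themselves; its values outside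
  \<open>min_gens H\<close> are irrelevant.\<close>

definition homogeneous :: "nat set \<Rightarrow> bool" where
  "homogeneous H \<longleftrightarrow>
     (\<forall>s \<in> apery H (multiplicity_of H). s \<noteq> 0 \<longrightarrow>
        (\<forall>a b :: nat \<Rightarrow> nat.
           (\<Sum>h\<in>min_gens H. a h * h) = s \<longrightarrow> (\<Sum>h\<in>min_gens H. b h * h) = s \<longrightarrow>
           (\<Sum>h\<in>min_gens H. a h) = (\<Sum>h\<in>min_gens H. b h)))"


subsection \<open>Existence and uniqueness of the minimal generators\<close>

lemma submonoid_gen_incl: "a \<in> A \<Longrightarrow> a \<in> submonoid_gen A"
  using submonoid_gen.add[of a A 0] submonoid_gen.zero by simp

lemma submonoid_gen_add:
  "x \<in> submonoid_gen A \<Longrightarrow> y \<in> submonoid_gen A \<Longrightarrow> x + y \<in> submonoid_gen A"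
  by (induction rule: submonoid_gen.induct) (auto simp: add.assoc intro: submonoid_gen.add)

definition atoms :: "nat set \<Rightarrow> nat set" where
  "atoms H = {h \<in> H. h \<noteq> 0 \<and> \<not> (\<exists>a\<in>H. \<exists>b\<in>H. a \<noteq> 0 \<and> b \<noteq> 0 \<and> h = a + b)}"

lemma atoms_subset_generators:
  assumes "submonoid_gen B = H"
  shows "atoms H \<subseteq> B"
proof
  fix h assume h: "h \<in> atoms H"
  then have "h \<in> submonoid_gen B" using assms by (simp add: atoms_def)
  then show "h \<in> B" using h
  proof (induction rule: submonoid_gen.induct)
    case zero
    then show ?case by (simp add: atoms_def)
  next
    case (add a x)
    have "a \<in> H" "x \<in> H" using add.hyps assms submonoid_gen_incl by auto
    then have "a = 0 \<or> x = 0" using add.prems by (auto simp: atoms_def)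
    then show ?case using add by auto
  qed
qed

lemma submonoid_gen_atoms:
  assumes "submonoid_gen A = H"
  shows "submonoid_gen (atoms H) = H"
proof
  show "submonoid_gen (atoms H) \<subseteq> H"
  proof
    fix x assume "x \<in> submonoid_gen (atoms H)"
    then show "x \<in> H"
      by (induction rule: submonoid_gen.induct)
        (use assms submonoid_gen.zero submonoid_gen_add in \<open>auto simp: atoms_def\<close>)
  qed
  show "H \<subseteq> submonoid_gen (atoms H)"
  proof
    fix h assume "h \<in> H"
    then show "h \<in> submonoid_gen (atoms H)"
    proof (induction h rule: less_induct)
      case (less h)
      consider "h = 0" | "h \<in> atoms H"
        | a b where "a \<in> H" "b \<in> H" "a \<noteq> 0" "b \<noteq> 0" "h = a + b"
        using less.prems by (auto simp: atoms_def)
      then show ?case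
      proof cases
        case 3
        then have "a < h" "b < h" by auto
        then show ?thesis using 3 less.IH submonoid_gen_add by blast
      qed (auto intro: submonoid_gen.zero submonoid_gen_incl)
    qed
  qed
qed

lemma minimal_generators_unique:
  assumes "minimal_generators A H"
  shows "A = atoms H"
  using assms atoms_subset_generators[of A H] submonoid_gen_atoms[of A H]
  unfolding minimal_generators_def by blast

lemma minimal_generators_atoms:
  assumes "submonoid_gen A = H"
  shows "minimal_generators (atoms H) H"
  using submonoid_gen_atoms[OF assms] atoms_subset_generators
  unfolding minimal_generators_def by blast

lemma min_gens_eq_atoms: "submonoid_gen A = H \<Longrightarrow> min_gens H = atoms H"
  unfolding min_gens_def
  by (rule the_equality) (erule minimal_generators_atoms, erule minimal_generators_unique)

lemma min_gens_minimal_generators: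
  "submonoid_gen A = H \<Longrightarrow> minimal_generators (min_gens H) H"
  by (simp add: min_gens_eq_atoms minimal_generators_atoms)


section \<open>The semigroup ring and its tangent cone\<close>

text \<open>The subring of the polynomial ring generated by the constants and the \<open>t ^ h\<close>, where
  \<open>h\<close> ranges over the minimal generators.\<close>

definition semigroup_ring :: "'k::field itself \<Rightarrow> nat set \<Rightarrow> 'k poly ring" where
  "semigroup_ring _ H =
     (ring_of_type_algebra :: 'k poly ring)
       \<lparr>carrier := generate_ring (ring_of_type_algebra :: 'k poly ring)
          (range (\<lambda>c. [:c:]) \<union> Polynomial.monom 1 ` min_gens H)\<rparr>"

definition semigroup_ideal :: "'k::field itself \<Rightarrow> nat set \<Rightarrow> 'k poly set" where
  "semigroup_ideal K H =
     genideal (semigroup_ring K H) (Polynomial.monom 1 ` min_gens H)"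

fun ideal_pow :: "('a, 'b) ring_scheme \<Rightarrow> 'a set \<Rightarrow> nat \<Rightarrow> 'a set" where
  "ideal_pow R I 0 = carrier R"
| "ideal_pow R I (Suc n) = ideal_prod R (ideal_pow R I n) I"

text \<open>An element of the direct sum of the \<open>I ^ n / I ^ (n + 1)\<close> is a function sending \<open>n\<close> to a
  coset of \<open>I ^ (n + 1)\<close> with a representative in \<open>I ^ n\<close>, almost all of these cosets being zero.
  The product of the classes of \<open>a\<close> in \<open>I ^ i / I ^ (i + 1)\<close> and \<open>b\<close> in \<open>I ^ j / I ^ (j + 1)\<close> is
  the class of \<open>a b\<close> modulo \<open>I ^ (i + j + 1)\<close>.\<close>

definition assoc_graded :: "('a, 'b) ring_scheme \<Rightarrow> 'a set \<Rightarrow> (nat \<Rightarrow> 'a set) ring" where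
  "assoc_graded R I =
     \<lparr>carrier = {f. (\<forall>n. \<exists>a \<in> ideal_pow R I n. f n = ideal_pow R I (Suc n) +>\<^bsub>R\<^esub> a)
                  \<and> finite {n. f n \<noteq> ideal_pow R I (Suc n)}},
      monoid.mult = (\<lambda>f g n. finsum (R Quot ideal_pow R I (Suc n))
                 (\<lambda>i. rcoset_mult R (ideal_pow R I (Suc n)) (f i) (g (n - i))) {..n}),
      one = (\<lambda>n. if n = 0 then ideal_pow R I (Suc 0) +>\<^bsub>R\<^esub> \<one>\<^bsub>R\<^esub> else ideal_pow R I (Suc n)),
      zero = (\<lambda>n. ideal_pow R I (Suc n)),
      add = (\<lambda>f g n. f n <+>\<^bsub>R\<^esub> g n)\<rparr>"

definition tangent_cone :: "'k::field itself \<Rightarrow> nat set \<Rightarrow> (nat \<Rightarrow> 'k poly set) ring" where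
  "tangent_cone K H = assoc_graded (semigroup_ring K H) (semigroup_ideal K H)"


section \<open>Cohen-Macaulay rings\<close>

definition regular_sequence :: "('a, 'b) ring_scheme \<Rightarrow> 'a list \<Rightarrow> bool" where
  "regular_sequence R xs \<longleftrightarrow>
     set xs \<subseteq> carrier R \<and>
     (\<forall>i < length xs. \<forall>r \<in> carrier R.
        xs ! i \<otimes>\<^bsub>R\<^esub> r \<in> genideal R (set (take i xs)) \<longrightarrow> r \<in> genideal R (set (take i xs))) \<and>
     genideal R (set xs) \<noteq> carrier R"

definition depth :: "('a, 'b) ring_scheme \<Rightarrow> 'a set \<Rightarrow> enat" where
  "depth R I = (SUP xs \<in> {xs. regular_sequence R xs \<and> set xs \<subseteq> I}. enat (length xs))"

definition height :: "('a, 'b) ring_scheme \<Rightarrow> 'a set \<Rightarrow> enat" where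
  "height R P = (SUP n \<in> {n. \<exists>C. (\<forall>i\<le>n. primeideal (C i) R) \<and> (\<forall>i<n. C i \<subset> C (Suc i)) \<and> C n = P}.
     enat n)"

text \<open>This is the definition of Eisenbud, Commutative Algebra with a View Toward Algebraic
  Geometry, Section 18.2. The depth and the height of a maximal ideal \<open>P\<close> are the depth and the
  Krull dimension of the local ring at \<open>P\<close>.\<close>

definition cohen_macaulay :: "('a, 'b) ring_scheme \<Rightarrow> bool" where
  "cohen_macaulay R \<longleftrightarrow>
     cring R \<and> noetherian_ring R \<and> (\<forall>P. maximalideal P R \<longrightarrow> depth R P = height R P)"

end

theory Submission
  imports Defs
begin

text \<open>Measure a generator of \<open>S + j\<close> by its complement in the largest generator. If an element has
  factorizations of lengths \<open>p < q\<close>, the longer one has total complement at least \<open>n_d + j\<close>, and the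
  conductor of \<open>T\<close> lets one rewrite it, without losing length, so that the smallest generator \<open>e\<close>
  occurs. This exchange property gives homogeneity at once. It also shows that the class \<open>x\<close> of
  \<open>t ^ e\<close> in degree one is a nonzerodivisor of the tangent cone, which is therefore free over
  \<open>k[x]\<close> on the classes of the Apery elements; all of these but \<open>1\<close> are nilpotent, since \<open>e\<close> copies
  of \<open>w\<close> can be replaced by \<open>w\<close> copies of \<open>e\<close>. Up to nilpotents the tangent cone is thus \<open>k[x]\<close>, so
  every maximal ideal has height and depth one. The ring axioms for the tangent cone are inherited
  from the Rees algebra, realised inside the polynomials in two variables.\<close>

section \<open>The exchange property of shifted semigroups\<close>

text \<open>The constant \<open>L\<close> comes from comparing densities. Write
  \<open>M = g * c + m_1\<close> and \<open>\<mu> = m_(d-1)\<close>. Rewriting the complement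
  \<open>W\<close> uses at most \<open>W / m_1 + M / \<mu>\<close> nonzero complements, while a list
  avoiding the smallest generator has at least \<open>W / m_2\<close> terms. Since
  \<open>m_1 - m_2 \<ge> 1\<close>, the gap between \<open>W / m_2\<close> and
  \<open>W / m_1\<close> is at least \<open>W / (m_1 * m_2)\<close>, so
  \<open>W \<ge> n_d + j > m_1 * m_2 * M / \<mu>\<close> suffices.

  The summand \<open>d\<close> in \<open>L\<close> serves another purpose: for
  \<open>d \<ge> 3\<close> it forces \<open>n_d + j > 2 * m_1\<close>, which makes all given
  generators minimal. For \<open>d = 2\<close> one has \<open>m_2 = 0\<close> and
  \<open>L = - n_2\<close>, so \<open>n_2 + j\<close> may be a multiple of \<open>n_1 + j\<close>;
  hence the exchange property is formulated for the minimal generators.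

  Cohen-Macaulayness is a condition at every maximal ideal, not only at the homogeneous one, so each
  of them must contain a nonzerodivisor. Comparing lowest terms extends regularity from
  \<open>x\<close> to every nonzero polynomial in \<open>x\<close>.\<close>

text \<open>A list over \<open>A\<close> plays the role of a factorization: its length counts
  generators with multiplicity, the quantity compared throughout.\<close>

lemma submonoid_gen_iff_sum_list:
  "x \<in> submonoid_gen A \<longleftrightarrow> (\<exists>xs. set xs \<subseteq> A \<and> sum_list xs = x)"
proof
  show "x \<in> submonoid_gen A \<Longrightarrow> \<exists>xs. set xs \<subseteq> A \<and> sum_list xs = x"
  proof (induction rule: submonoid_gen.induct)
    case zero
    then show ?case by (intro exI[of _ "[]"]) simp
  next
    case (add a x)
    then obtain xs where "set xs \<subseteq> A" "sum_list xs = x" by blast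
    then show ?case using add.hyps by (intro exI[of _ "a # xs"]) simp
  qed
next
  assume "\<exists>xs. set xs \<subseteq> A \<and> sum_list xs = x"
  then obtain xs where "set xs \<subseteq> A" "sum_list xs = x" by blast
  then show "x \<in> submonoid_gen A"
    by (induction xs arbitrary: x) (auto intro: submonoid_gen.intros)
qed

lemma submonoid_gen_mult: "x \<in> submonoid_gen A \<Longrightarrow> k * x \<in> submonoid_gen A"
  by (induction k) (auto intro: submonoid_gen.zero submonoid_gen_add)

text \<open>The least positive difference of two elements divides every generator by division with
  remainder, hence it is \<open>1\<close>.\<close>

lemma submonoid_gen_consecutive:
  assumes "Gcd A = (1::nat)"
  shows "\<exists>x. x \<in> submonoid_gen A \<and> Suc x \<in> submonoid_gen A"
proof -
  let ?T = "submonoid_gen A"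
  let ?P = "\<lambda>k. k > 0 \<and> (\<exists>x\<in>?T. x + k \<in> ?T)"
  have "\<exists>a\<in>A. a > 0"
    using assms by (metis Gcd_0_iff bot_nat_0.not_eq_extremum insertI1 subsetI zero_neq_one)
  then have ex: "\<exists>k. ?P k"
    using submonoid_gen.zero submonoid_gen_incl by (metis add_0)
  define k where "k = (LEAST k. ?P k)"
  have k: "?P k" unfolding k_def by (rule LeastI_ex[OF ex])
  have min: "\<not> ?P l" if "l < k" for l using that unfolding k_def by (rule not_less_Least)
  from k obtain x where x: "x \<in> ?T" "x + k \<in> ?T" by blast
  have "k dvd a" if "a \<in> A" for a
  proof -
    let ?q = "a div k"
    have 1: "?q * (x + k) \<in> ?T" by (intro submonoid_gen_mult x)
    have 2: "a + ?q * x \<in> ?T" by (intro submonoid_gen.add submonoid_gen_mult x that)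
    have "a + ?q * x = ?q * (x + k) + a mod k"
      by (simp add: algebra_simps)
    then have "\<not> a mod k > 0" using 1 2 min[of "a mod k"] k by auto
    then show ?thesis by auto
  qed
  then have "k dvd Gcd A" by (rule Gcd_greatest)
  then show ?thesis using assms x by auto
qed

text \<open>With \<open>x\<close> and \<open>x + 1\<close> at hand, \<open>n = q * x + r\<close> is
  reached by trading \<open>r\<close> of the \<open>q\<close> copies of \<open>x\<close> for
  \<open>x + 1\<close>. There are enough copies once \<open>n \<ge> x * x\<close>.\<close>

lemma submonoid_gen_cofinite:
  assumes "Gcd A = (1::nat)"
  shows "\<exists>c. \<forall>n\<ge>c. n \<in> submonoid_gen A"
proof -
  obtain x where x: "x \<in> submonoid_gen A" "Suc x \<in> submonoid_gen A"
    using submonoid_gen_consecutive[OF assms] by blast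
  have "n \<in> submonoid_gen A" if n: "n \<ge> x * x" for n
  proof (cases "x = 0")
    case True
    then show ?thesis using submonoid_gen_mult[OF x(2), of n] by simp
  next
    case False
    define q r where "q = n div x" and "r = n mod x"
    have "x \<le> q" using n False unfolding q_def by (simp add: less_eq_div_iff_mult_less_eq)
    moreover have "r < x" using False by (simp add: r_def)
    ultimately have "r \<le> q" by linarith
    have "n = q * x + r" by (simp add: q_def r_def)
    also have "\<dots> = (q - r) * x + r * Suc x"
      using \<open>r \<le> q\<close> by (simp add: diff_mult_distrib)
    finally show ?thesis
      using submonoid_gen_add[OF submonoid_gen_mult[OF x(1)] submonoid_gen_mult[OF x(2)]] by metis
  qed
  then show ?thesis by blast
qed

text \<open>Cofiniteness supplies the witness without which the \<open>LEAST\<close> in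
  \<open>conductor\<close> would carry no information.\<close>

lemma conductor_le_imp_mem:
  assumes "Gcd A = 1" "conductor (submonoid_gen A) \<le> x"
  shows "x \<in> submonoid_gen A"
proof -
  let ?P = "\<lambda>c. c \<in> submonoid_gen A \<and> (\<forall>i>0. c + i \<in> submonoid_gen A)"
  obtain c where "\<forall>n\<ge>c. n \<in> submonoid_gen A"
    using submonoid_gen_cofinite[OF assms(1)] by blast
  then have "?P c" by simp
  then have P: "?P (conductor (submonoid_gen A))" unfolding conductor_def by (rule LeastI)
  obtain i where "x = conductor (submonoid_gen A) + i" using assms(2) le_Suc_ex by blast
  with P show ?thesis by (cases "i = 0") auto
qed

section \<open>Rewriting factorizations through complements\<close>

lemma sum_list_complement:
  assumes "\<And>y. y \<in> set ys \<Longrightarrow> y \<le> (N::nat)"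
  shows "sum_list ys + sum_list (map (\<lambda>y. N - y) ys) = N * length ys"
  using assms
proof (induction ys)
  case (Cons y ys)
  then have "y \<le> N" and "sum_list ys + sum_list (map (\<lambda>y. N - y) ys) = N * length ys" by auto
  then show ?case by simp
qed simp

lemma length_mult_le_sum_list:
  assumes "\<And>y. y \<in> set ys \<Longrightarrow> (e::nat) \<le> y"
  shows "length ys * e \<le> sum_list ys"
  using assms by (induction ys) (auto intro: add_mono)

lemma sum_list_le_length_mult:
  assumes "\<And>y. y \<in> set ys \<Longrightarrow> y \<le> (e::nat)"
  shows "sum_list ys \<le> length ys * e"
  using assms by (induction ys) (auto intro: add_mono)

text \<open>In terms of the complements \<open>N - a\<close>, two factorizations of different lengths have total
  complements differing by at least \<open>N\<close>, so the longer one has complement \<open>W \<ge> N\<close>. If it avoids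
  the smallest generator \<open>N - m1\<close>, it has at least \<open>W / m2\<close> terms, whereas writing
  \<open>W = k * m1 + r\<close> with \<open>g * c \<le> r < g * c + m1\<close> needs at most
  \<open>k + r / \<mu>\<close> terms, which is fewer.\<close>

lemma exchange_count:
  fixes W N k r t q :: nat
  assumes "\<mu> > 0" "\<mu> \<le> m2" "m2 < m1" and W: "W = k * m1 + r" and "t * \<mu> \<le> r"
    and q: "W \<le> m2 * q" and r: "r \<le> M" and N: "m1 * m2 * M < W * \<mu>"
  shows "k + t \<le> q"
proof (rule ccontr)
  assume "\<not> k + t \<le> q"
  then have "Suc q \<le> k + t" by simp
  then have "m2 * Suc q \<le> m2 * (k + t)" by (rule mult_le_mono2)
  then have "W < m2 * (k + t)" using q assms(1,2) by simp
  then have "W * \<mu> < m2 * (k + t) * \<mu>" using assms(1) by simp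
  also have "\<dots> = m2 * k * \<mu> + m2 * (t * \<mu>)" by (simp add: algebra_simps)
  also have "\<dots> \<le> m2 * k * \<mu> + m2 * r" using assms(5) by simp
  finally have *: "W * \<mu> < m2 * k * \<mu> + m2 * r" .
  \<comment> \<open>Being a positive integer, \<open>a\<close> is at least 1. This is the gap
    between \<open>1 / m2\<close> and \<open>1 / m1\<close> cleared of denominators, and the origin
    of the factor \<open>m1 * m2\<close> in the bound.\<close>
  define a where "a = m1 - m2"
  have m1: "m1 = m2 + a" "a > 0" using assms(3) by (auto simp: a_def)
  have **: "k * a * \<mu> + r * \<mu> < m2 * r" using * by (simp add: W m1 algebra_simps)
  have "W * \<mu> * a \<le> (k * a * \<mu> + r * \<mu>) * m1"
    by (simp add: W m1 algebra_simps)
  also have "\<dots> \<le> m2 * r * m1" using ** by (intro mult_right_mono) auto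
  also have "\<dots> \<le> m1 * m2 * M" using r by simp
  also have "\<dots> < W * \<mu>" by (fact N)
  finally show False using m1(2) by simp
qed

lemma remove_smallest_generator:
  fixes e :: nat
  assumes "e \<in> set ys" "set ys \<subseteq> B"
  shows "\<exists>zs. set zs \<subseteq> B \<and> length ys = Suc (length zs) \<and> sum_list ys = e + sum_list zs"
  using set_remove1_subset[of e ys] assms sum_list_map_remove1[OF assms(1), of id]
  by (intro exI[of _ "remove1 e ys"])
    (auto simp: length_remove1 Suc_diff_Suc dest: length_pos_if_in_set)

text \<open>\<open>D\<close> holds the complements, with \<open>0\<close> standing for the largest
  generator \<open>N\<close>. A sum of \<open>q\<close> terms with total complement \<open>W\<close>
  equals \<open>N * q - W\<close>, so lists with the same length and the same \<open>W\<close> have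
  the same sum. As copies of \<open>N\<close> add length but no complement, it suffices to write
  \<open>W\<close> with at most \<open>q\<close> nonzero complements, one of them
  \<open>m1\<close>.\<close>

lemma exchange_smallest_generator:
  fixes m1 m2 \<mu> N :: nat
  assumes D: "m1 \<in> D" "0 \<in> D" "m1 \<le> N"
    and le: "\<And>x. x \<in> D \<Longrightarrow> x \<le> N"
    and \<mu>: "\<mu> > 0" "\<And>x. x \<in> D \<Longrightarrow> x = 0 \<or> \<mu> \<le> x" "\<mu> \<le> m2"
    and m2: "m2 < m1" "\<And>x. x \<in> D \<Longrightarrow> x = m1 \<or> x \<le> m2"
    and g: "g = Gcd D" and c: "\<And>x. conductor (submonoid_gen ((\<lambda>x. x div g) ` (D - {0}))) \<le> x \<Longrightarrow>
       x \<in> submonoid_gen ((\<lambda>x. x div g) ` (D - {0}))"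
    and N: "m1 * m2 * (g * conductor (submonoid_gen ((\<lambda>x. x div g) ` (D - {0}))) + m1) < N * \<mu>"
    and ys: "set ys \<subseteq> (\<lambda>x. N - x) ` D" and xs: "set xs \<subseteq> (\<lambda>x. N - x) ` D"
    and eq: "sum_list xs = sum_list ys" and len: "length xs < length ys"
  shows "\<exists>zs. set zs \<subseteq> (\<lambda>x. N - x) ` D \<and> length ys = Suc (length zs) \<and> sum_list ys = (N - m1) + sum_list zs"
proof (cases "N - m1 \<in> set ys")
  case True
  then show ?thesis using ys by (rule remove_smallest_generator)
next
  case False
  let ?T = "submonoid_gen ((\<lambda>x. x div g) ` (D - {0}))"
  define M where "M = g * conductor ?T + m1"
  define W where "W = sum_list (map (\<lambda>y. N - y) ys)"
  define q where "q = length ys"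
  have "m1 > 0" using m2 by simp
  have gpos: "g > 0" using g D(1) \<open>m1 > 0\<close> by (metis Gcd_0_iff bot_nat_0.not_eq_extremum singletonD subsetD)
  have 1: "sum_list ys + W = N * q" unfolding W_def q_def using ys by (intro sum_list_complement) auto
  have "sum_list xs + sum_list (map (\<lambda>y. N - y) xs) = N * length xs"
    using xs by (intro sum_list_complement) auto
  moreover have "N * length xs + N \<le> N * q" using len mult_le_mono2[of "Suc (length xs)" q N] by (simp add: q_def)
  ultimately have WN: "W \<ge> N" using 1 eq by linarith
  have "N - y \<le> m2" if "y \<in> set ys" for y
    using that ys False m2(2) le by (metis (no_types, lifting) diff_diff_cancel imageE subsetD)
  then have Wm2: "W \<le> m2 * q" unfolding W_def q_def
    using sum_list_le_length_mult[of "map (\<lambda>y. N - y) ys" m2] by (auto simp: mult.commute)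
  have "g dvd N - y" if "y \<in> set ys" for y
    using that ys g le by (auto intro!: Gcd_dvd)
  then have gW: "g dvd W" unfolding W_def by (induction ys) auto
  have "m2 > 0" using \<mu> by simp
  have "M * \<mu> \<le> m1 * m2 * M" using \<mu>(3) \<open>m1 > 0\<close> mult_le_mono[of 1 m1 \<mu> m2]
    by (simp add: mult.commute)
  also have "\<dots> < N * \<mu>" using N by (simp add: M_def)
  finally have "M < N" by simp
  \<comment> \<open>Division by \<open>m1\<close> starts from \<open>g * conductor ?T\<close>
    instead of 0, so that \<open>r / g\<close> reaches the conductor and \<open>r\<close> becomes a
    sum of complements.\<close>
  define k where "k = (W - g * conductor ?T) div m1"
  define r where "r = g * conductor ?T + (W - g * conductor ?T) mod m1"
  have MW: "M < W" using \<open>M < N\<close> WN by simp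
  then have W: "W = k * m1 + r" by (simp add: k_def r_def M_def)
  have rM: "r \<le> M" using \<open>m1 > 0\<close> by (simp add: r_def M_def)
  \<comment> \<open>At least one \<open>m1\<close> is used, so the smallest generator does
    occur.\<close>
  have "k > 0" using MW W rM by (cases k) auto
  have "g dvd m1" using D(1) g by auto
  then have "g dvd r" using gW W by (simp add: dvd_add_right_iff)
  then obtain r' where r': "r = g * r'" by blast
  have "conductor ?T \<le> r'" using r' gpos unfolding r_def
    by (metis le_add1 mult_le_cancel1)
  then have "r' \<in> ?T" by (rule c)
  then obtain ts where ts: "set ts \<subseteq> (\<lambda>x. x div g) ` (D - {0})" "sum_list ts = r'"
    unfolding submonoid_gen_iff_sum_list by blast
  have gts: "g * t \<in> D \<and> g * t \<noteq> 0" if "t \<in> set ts" for t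
  proof -
    have "t \<in> (\<lambda>x. x div g) ` (D - {0})" using that ts(1) by blast
    then obtain x where x: "x \<in> D - {0}" "t = x div g" by (rule imageE) blast
    then have "g dvd x" using g by auto
    then have "g * t = x" using x(2) by simp
    then show ?thesis using x(1) by simp
  qed
  have rts: "r = sum_list (map (\<lambda>t. g * t) ts)" using ts(2) r' sum_list_const_mult[of g "\<lambda>x. x" ts] by simp
  have "length ts * \<mu> \<le> r" unfolding rts
    using length_mult_le_sum_list[of "map (\<lambda>t. g * t) ts" \<mu>] \<mu>(2) gts by fastforce
  moreover have "m1 * m2 * M < W * \<mu>"
    using N WN mult_le_mono1[OF WN, of \<mu>] unfolding M_def by linarith
  ultimately have kq: "k + length ts \<le> q"
    using exchange_count[OF \<mu>(1,3) m2(1) W _ Wm2 rM] by blast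
  define us where "us = map (\<lambda>t. N - g * t) ts"
  have us: "sum_list us + r = N * length ts"
  proof -
    have "sum_list us + sum_list (map (\<lambda>y. N - y) us) = N * length us"
      by (intro sum_list_complement) (auto simp: us_def)
    moreover have "map (\<lambda>y. N - y) us = map (\<lambda>t. g * t) ts"
      using gts le by (auto simp: us_def)
    ultimately show ?thesis unfolding rts by (simp only: us_def length_map)
  qed
  \<comment> \<open>One of the \<open>k\<close> copies of \<open>N - m1\<close> is the one split
    off, hence \<open>k - 1\<close>. Padding with \<open>N\<close> restores the length of
    \<open>ys\<close>.\<close>
  define zs where "zs = replicate (k - 1) (N - m1) @ us @ replicate (q - (k + length ts)) N"
  obtain k' where k': "k = Suc k'" using \<open>k > 0\<close> by (cases k) auto
  obtain l where l: "q = k + length ts + l" using kq le_Suc_ex by blast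
  obtain N' where N': "N = N' + m1" using D(3) by (metis le_add_diff_inverse2)
  have "set zs \<subseteq> (\<lambda>x. N - x) ` D"
    unfolding zs_def us_def using D gts by (auto simp: set_replicate_conv_if intro!: image_eqI[of N _ 0] split: if_splits)
  moreover have "length ys = Suc (length zs)" using k' l by (simp add: zs_def us_def q_def)
  moreover have "sum_list ys = (N - m1) + sum_list zs"
  proof -
    have "sum_list zs = k' * N' + sum_list us + l * N"
      by (simp add: zs_def sum_list_replicate k' l N')
    then have "(N - m1) + sum_list zs + W = N * q"
      using us by (simp add: W k' l N' algebra_simps)
    with 1 show ?thesis by simp
  qed
  ultimately show ?thesis by blast
qed

section \<open>The abstract exchange property and homogeneity\<close>

lemma multiset_as_list:
  fixes a :: "nat \<Rightarrow> nat"
  assumes "finite B"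
  shows "\<exists>xs. set xs \<subseteq> B \<and> length xs = (\<Sum>h\<in>B. a h) \<and> sum_list xs = (\<Sum>h\<in>B. a h * h)"
  using assms
proof (induction B)
  case (insert b B)
  then obtain xs where "set xs \<subseteq> B" "length xs = (\<Sum>h\<in>B. a h)" "sum_list xs = (\<Sum>h\<in>B. a h * h)" by blast
  then show ?case using insert.hyps
    by (intro exI[of _ "replicate (a b) b @ xs"]) (auto simp: sum_list_replicate)
qed simp

lemma le_submonoid_gen:
  assumes "x \<in> submonoid_gen A" "x \<noteq> 0" "\<And>a. a \<in> A \<Longrightarrow> e \<le> a"
  shows "e \<le> x"
  using assms by (induction rule: submonoid_gen.induct) (auto intro: trans_le_add1)

text \<open>The length in \<open>exchange\<close> is kept exactly: homogeneity only subtracts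
  \<open>e\<close>, but cancelling \<open>e\<close> in the filtration needs to know that
  \<open>length ys - 1\<close> terms remain.\<close>

locale exchange_semigroup =
  fixes B :: "nat set" and e :: nat
  assumes finite_B: "finite B" and e_in: "e \<in> B" and e_pos: "e > 0" and e_le: "h \<in> B \<Longrightarrow> e \<le> h"
    and exchange: "\<lbrakk>set xs \<subseteq> B; set ys \<subseteq> B; sum_list xs = sum_list ys; length xs < length ys\<rbrakk> \<Longrightarrow>
      \<exists>zs. set zs \<subseteq> B \<and> length ys = Suc (length zs) \<and> sum_list ys = e + sum_list zs"

lemma (in exchange_semigroup) homogeneous:
  assumes "min_gens (submonoid_gen B) = B"
  shows "homogeneous (submonoid_gen B)"
proof -
  have mult: "multiplicity_of (submonoid_gen B) = e"
    unfolding multiplicity_of_def assms by (rule Min_eqI) (auto simp: finite_B e_in e_le)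
  have no: False if st: "s \<in> apery (submonoid_gen B) e" "set xs \<subseteq> B" "set ys \<subseteq> B"
    "sum_list xs = s" "sum_list ys = s" "length xs < length ys" for s xs ys
  proof -
    have "sum_list xs = sum_list ys" using st by simp
    then obtain zs where "set zs \<subseteq> B" "s = e + sum_list zs"
      using exchange[of xs ys] st(2,3,5,6) by auto
    then have "sum_list zs \<in> submonoid_gen B" "s = sum_list zs + e"
      by (auto simp: submonoid_gen_iff_sum_list)
    then show False using st(1) by (auto simp: apery_def)
  qed
  show ?thesis
    unfolding homogeneous_def mult assms
  proof (intro ballI impI allI)
    fix s a b
    assume s: "s \<in> apery (submonoid_gen B) e" and ab: "(\<Sum>h\<in>B. a h * h) = s" "(\<Sum>h\<in>B. b h * h) = s"
    obtain xs where xs: "set xs \<subseteq> B" "length xs = (\<Sum>h\<in>B. a h)" "sum_list xs = s"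
      using multiset_as_list[OF finite_B, of a] ab by metis
    obtain ys where ys: "set ys \<subseteq> B" "length ys = (\<Sum>h\<in>B. b h)" "sum_list ys = s"
      using multiset_as_list[OF finite_B, of b] ab by metis
    show "(\<Sum>h\<in>B. a h) = (\<Sum>h\<in>B. b h)"
      using no[OF s xs(1) ys(1)] no[OF s ys(1) xs(1)] xs ys by (metis linorder_neqE_nat)
  qed
qed

lemma exchange_semigroup_shift:
  fixes d :: nat and n m :: "nat \<Rightarrow> nat" and g c j :: nat and T H :: "nat set" and L :: real
  assumes d: "d \<ge> 2"
    and pos: "\<And>i. i \<in> {1..d} \<Longrightarrow> n i > 0"
    and mono: "strict_mono_on {1..d} n"
    and m: "\<And>i. i \<in> {1..d} \<Longrightarrow> m i = n d - n i"
    and g: "g = Gcd (m ` {1..d - 1})"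
    and T: "T = submonoid_gen ((\<lambda>i. m i div g) ` {1..d - 1})"
    and c: "c = conductor T"
    and L: "L = real (m 1) * real (m 2) * ((real g * real c + real (m 1)) / real (m (d - 1)) + real d)
             - real (n d)"
    and j: "real j > L"
    and H: "H = submonoid_gen ((\<lambda>i. n i + j) ` {1..d})"
  shows "exchange_semigroup (min_gens H) (n 1 + j)"
proof -
  define N where "N = n d + j"
  define G where "G = (\<lambda>i. n i + j) ` {1..d}"
  have B: "min_gens H = atoms H" using H by (intro min_gens_eq_atoms) simp
  have sub: "atoms H \<subseteq> G" using atoms_subset_generators H unfolding G_def by metis
  have n1: "n 1 \<le> n i" if "i \<in> {1..d}" for i
    using that mono d by (cases "i = 1") (auto simp: strict_mono_on_def intro: less_imp_le)
  have nd: "n i < n d" if "i \<in> {1..<d}" for i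
    using that mono d by (auto simp: strict_mono_on_def)
  have nd': "n i \<le> n d" if "i \<in> {1..d}" for i
    using that nd[of i] by (cases "i = d") (auto intro: less_imp_le)
  have HG: "H = submonoid_gen G" using H by (simp add: G_def)
  have Hge: "n 1 + j \<le> x" if "x \<in> H" "x \<noteq> 0" for x
  proof (rule le_submonoid_gen)
    show "x \<in> submonoid_gen G" using that HG by simp
    show "n 1 + j \<le> a" if "a \<in> G" for a using that n1 by (auto simp: G_def)
  qed (fact that)
  have epos: "n 1 + j > 0" using pos[of 1] d by simp
  have "n 1 + j \<in> H" unfolding HG G_def using d by (intro submonoid_gen_incl) auto
  then have e_in: "n 1 + j \<in> atoms H"
    unfolding atoms_def using Hge epos by fastforce
  have e_le: "n 1 + j \<le> h" if "h \<in> atoms H" for h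
    using that Hge by (auto simp: atoms_def)
  show ?thesis
  proof (unfold B, unfold_locales)
    show "finite (atoms H)" using sub by (rule finite_subset) (simp add: G_def)
    show "n 1 + j \<in> atoms H" "n 1 + j > 0" by (fact e_in epos)+
    show "n 1 + j \<le> h" if "h \<in> atoms H" for h by (rule e_le[OF that])
    fix xs ys
    assume xy: "set xs \<subseteq> atoms H" "set ys \<subseteq> atoms H" "sum_list xs = sum_list ys" "length xs < length ys"
    show "\<exists>zs. set zs \<subseteq> atoms H \<and> length ys = Suc (length zs) \<and> sum_list ys = n 1 + j + sum_list zs"
    proof (cases "d = 2")
      \<comment> \<open>Here \<open>m 2 = 0\<close>, so the comparison of densities does not apply.
        There are only two given generators; a list avoiding \<open>n 1 + j\<close> consists of
        copies of \<open>N\<close>, and a shorter list cannot reach its sum.\<close>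
      case True
      have "n 1 + j \<in> set ys"
      proof (rule ccontr)
        assume no: "n 1 + j \<notin> set ys"
        have "{1..d} = {1, 2}" using True by auto
        then have G2: "G = {n 1 + j, N}" using True by (auto simp: G_def N_def)
        have "sum_list xs \<le> length xs * N"
          using xy(1) sub nd' by (intro sum_list_le_length_mult) (auto simp: G_def N_def)
        moreover have "length ys * N \<le> sum_list ys"
          using xy(2) sub no unfolding G2 by (intro length_mult_le_sum_list) auto
        moreover have "length xs * N < length ys * N"
          using xy(4) pos[of d] d by (simp add: N_def)
        ultimately show False using xy(3) by linarith
      qed
      then show ?thesis using remove_smallest_generator[of "n 1 + j" ys "atoms H"] xy(2) by blast
    next
      case False
      then have d3: "d \<ge> 3" using d by simp
      define D where "D = m ` {1..d}"
      have md: "m d = 0" using m[of d] d by simp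
      have mpos: "m i > 0" if "i \<in> {1..<d}" for i using m[of i] nd[of i] that by auto
      have "{1..d} = insert d {1..d - 1}" using d by auto
      then have Dins: "D = insert 0 (m ` {1..d - 1})" using md by (simp add: D_def)
      have D0: "D - {0} = m ` {1..d - 1}" using mpos d unfolding Dins by fastforce
      have GD: "G = (\<lambda>x. N - x) ` D"
        unfolding G_def D_def image_image N_def using m nd' by (intro image_cong) auto
      have mlt: "m i' < m i" if "i \<in> {1..d}" "i' \<in> {1..d}" "i < i'" for i i'
      proof -
        have "n i < n i'" using mono that by (auto simp: strict_mono_on_def)
        then show ?thesis using m that nd'[OF that(2)] by simp
      qed
      have T': "T = submonoid_gen ((\<lambda>x. x div g) ` (D - {0}))"
        unfolding T D0 image_image ..
      have gD: "g = Gcd D" by (simp add: g Dins)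
      have "0 < m 1" "0 < m 2" "0 < m (d - 1)" using d3 by (intro mpos; simp)+
      then have "1 \<le> m 1" "1 \<le> m 2" "1 \<le> m (d - 1)" by simp_all
      define Y where "Y = (real g * real c + real (m 1)) / real (m (d - 1))"
      have "Y \<ge> 0" by (simp add: Y_def)
      have NX: "real N > real (m 1) * real (m 2) * (Y + real d)"
        using j by (simp add: L N_def Y_def)
      \<comment> \<open>The summand \<open>d \<ge> 3\<close> of \<open>L\<close> gives the room
        \<open>2 * m 1 < N\<close>, equivalently \<open>2 * (n 1 + j) > N\<close>.\<close>
      have "real (m 1) * 1 * 3 \<le> real (m 1) * real (m 2) * (Y + real d)"
        using \<open>1 \<le> m 2\<close> d3 \<open>Y \<ge> 0\<close> by (intro mult_mono) auto
      then have N2: "2 * m 1 < N" using NX by linarith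
      have "real (m 1) * real (m 2) * Y \<le> real (m 1) * real (m 2) * (Y + real d)"
        by (intro mult_left_mono) auto
      then have "real (m 1) * real (m 2) * Y < real N" using NX by linarith
      then have "real (m 1) * real (m 2) * Y * real (m (d - 1)) < real N * real (m (d - 1))"
        using \<open>1 \<le> m (d - 1)\<close> by simp
      then have "real (m 1) * real (m 2) * (real g * real c + real (m 1)) < real N * real (m (d - 1))"
        using \<open>1 \<le> m (d - 1)\<close> by (simp add: Y_def)
      then have "real (m 1 * m 2 * (g * c + m 1)) < real (N * m (d - 1))" by simp
      then have Nnat: "m 1 * m 2 * (g * c + m 1) < N * m (d - 1)" using of_nat_less_iff by blast
      have n1N: "n 1 + j = N - m 1" using m[of 1] nd'[of 1] d by (simp add: N_def)
      \<comment> \<open>The rewriting may call on every given generator, so all of them have to be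
        minimal. A sum of two nonzero elements is at least \<open>2 * (n 1 + j)\<close>, hence
        exceeds \<open>N\<close>.\<close>
      have "G \<subseteq> atoms H"
      proof
        fix h assume h: "h \<in> G"
        have "h \<noteq> 0" "h \<le> N" using h pos nd' by (auto simp: G_def N_def)
        moreover have "h \<in> H" unfolding HG using h by (rule submonoid_gen_incl)
        moreover have "h \<noteq> a + b" if "a \<in> H" "b \<in> H" "a \<noteq> 0" "b \<noteq> 0" for a b
          using Hge[of a] Hge[of b] that \<open>h \<le> N\<close> N2 n1N by auto
        ultimately show "h \<in> atoms H" by (auto simp: atoms_def)
      qed
      then have BG: "atoms H = (\<lambda>x. N - x) ` D" using sub GD by simp
      have gne: "g \<noteq> 0" using \<open>0 < m 1\<close> gD Gcd_dvd[of "m 1" D] d unfolding D_def by fastforce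
      have "Gcd ((\<lambda>x. x div g) ` (D - {0})) = 1"
      proof -
        let ?A = "(\<lambda>x. x div g) ` (D - {0})"
        have "g * Gcd ?A dvd x" if "x \<in> D" for x
        proof (cases "x = 0")
          case False
          then have "Gcd ?A dvd x div g" using that by (intro Gcd_dvd) auto
          moreover have "g dvd x" using that gD by auto
          ultimately show ?thesis by (metis dvd_mult_div_cancel mult_dvd_mono dvd_refl)
        qed simp
        then have "g * Gcd ?A dvd g" unfolding gD by (intro Gcd_greatest) (simp flip: gD)
        then show ?thesis using gne by simp
      qed
      note cond = conductor_le_imp_mem[OF this]
      show ?thesis unfolding BG n1N
      proof (rule exchange_smallest_generator[where g = g and \<mu> = "m (d - 1)" and ?m2.0 = "m 2" and xs = xs])
        show "m 1 \<in> D" "0 \<in> D" using d Dins by (auto simp: D_def)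
        show "m 1 \<le> N" using N2 by simp
        show "x \<le> N" if "x \<in> D" for x using that m by (auto simp: D_def N_def)
        show "m (d - 1) > 0" using \<open>1 \<le> m (d - 1)\<close> by simp
        show "x = 0 \<or> m (d - 1) \<le> x" if x: "x \<in> D" for x
        proof -
          obtain i where i: "i \<in> {1..d}" "x = m i" using x by (auto simp: D_def)
          consider "i = d" | "i = d - 1" | "i < d - 1" using i by fastforce
          then show ?thesis
          proof cases
            case 3
            then show ?thesis using mlt[of i "d - 1"] i d by simp
          qed (use i md in auto)
        qed
        have "d = 3 \<or> 2 < d - 1" using d3 by linarith
        then show "m (d - 1) \<le> m 2" using mlt[of 2 "d - 1"] d by auto
        show "m 2 < m 1" using mlt[of 1 2] d by simp
        show "x = m 1 \<or> x \<le> m 2" if x: "x \<in> D" for x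
        proof -
          obtain i where i: "i \<in> {1..d}" "x = m i" using x by (auto simp: D_def)
          consider "i = 1" | "i = 2" | "2 < i" using i by fastforce
          then show ?thesis
          proof cases
            case 3
            then show ?thesis using mlt[of 2 i] i d by simp
          qed (use i in auto)
        qed
        show "g = Gcd D" by (fact gD)
        show "m 1 * m 2 * (g * conductor (submonoid_gen ((\<lambda>x. x div g) ` (D - {0}))) + m 1) < N * m (d - 1)"
          using Nnat by (simp add: c T')
      qed (use xy BG cond in auto)
    qed
  qed
qed

section \<open>Nilpotent extensions of a polynomial ring\<close>

text \<open>Stated for bare sets of polynomials, since it is applied both to contractions of ideals
  and to sets of coefficients. For \<open>K = {0}\<close> the generator is \<open>0\<close>.\<close>

lemma poly_ideal_principal:
  fixes K :: "'k::field poly set"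
  assumes "0 \<in> K" "\<And>f g. f \<in> K \<Longrightarrow> g \<in> K \<Longrightarrow> f + g \<in> K" "\<And>f g. f \<in> K \<Longrightarrow> g * f \<in> K"
  shows "\<exists>p\<in>K. \<forall>f\<in>K. p dvd f"
proof (cases "K \<subseteq> {0}")
  case True
  then show ?thesis using assms(1) by (intro bexI[of _ 0]) auto
next
  case False
  then obtain f0 where f0: "f0 \<in> K \<and> f0 \<noteq> 0" by auto
  define p where "p = arg_min Polynomial.degree (\<lambda>f. f \<in> K \<and> f \<noteq> 0)"
  have p: "p \<in> K \<and> p \<noteq> 0" unfolding p_def using f0 by (rule arg_min_natI)
  have pmin: "Polynomial.degree p \<le> Polynomial.degree f" if "f \<in> K" "f \<noteq> 0" for f
    unfolding p_def using that by (intro arg_min_nat_le) simp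
  have "p dvd f" if "f \<in> K" for f
  proof -
    have "f mod p = f + (- (f div p)) * p" by (simp add: minus_div_mult_eq_mod[symmetric])
    then have "f mod p \<in> K" using assms(2,3) that p by metis
    moreover have "f mod p = 0 \<or> Polynomial.degree (f mod p) < Polynomial.degree p"
      using p by (intro degree_mod_less) simp
    ultimately have "f mod p = 0" using pmin by fastforce
    then show ?thesis by (simp add: mod_eq_0_iff_dvd)
  qed
  then show ?thesis using p by blast
qed

context cring
begin

definition nilradical :: "'a set" where
  "nilradical = {a \<in> carrier R. \<exists>n::nat. a [^] n = \<zero>}"

text \<open>A coarse binomial formula: every monomial of degree \<open>p + q\<close> contains
  \<open>a ^ p\<close> or \<open>b ^ q\<close>. The induction splits off one factor
  \<open>a \<oplus> b\<close>; the product with \<open>a\<close> uses the formula for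
  \<open>p - 1, q\<close>, the product with \<open>b\<close> the one for
  \<open>p, q - 1\<close>.\<close>

lemma add_pow_decomp:
  assumes "a \<in> carrier R" "b \<in> carrier R"
  shows "\<exists>x\<in>carrier R. \<exists>y\<in>carrier R. (a \<oplus> b) [^] (p + q) = (a [^] (p::nat)) \<otimes> x \<oplus> (b [^] (q::nat)) \<otimes> y"
proof (induction "p + q" arbitrary: p q)
  case 0
  then show ?case using assms by (intro bexI[of _ \<one>] bexI[of _ \<zero>]) auto
next
  case (Suc n)
  show ?case
  proof (cases "p = 0 \<or> q = 0")
    case True
    then show ?thesis
    proof
      assume "p = 0"
      then show ?thesis using assms
        by (intro bexI[of _ "(a \<oplus> b) [^] q"] bexI[of _ \<zero>]) auto
    next
      assume "q = 0"
      then show ?thesis using assms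
        by (intro bexI[of _ \<zero>] bexI[of _ "(a \<oplus> b) [^] p"]) auto
    qed
  next
    case False
    then obtain p' q' where pq: "p = Suc p'" "q = Suc q'" by (metis not0_implies_Suc)
    have "n = p' + q" "n = p + q'" using Suc.hyps pq by auto
    then obtain x y x' y' where xy: "x \<in> carrier R" "y \<in> carrier R" "x' \<in> carrier R" "y' \<in> carrier R"
      "(a \<oplus> b) [^] n = (a [^] p') \<otimes> x \<oplus> (b [^] q) \<otimes> y"
      "(a \<oplus> b) [^] n = (a [^] p) \<otimes> x' \<oplus> (b [^] q') \<otimes> y'"
      using Suc.hyps(1)[of p' q] Suc.hyps(1)[of p q'] by metis
    have "(a \<oplus> b) [^] (p + q) = (a \<oplus> b) [^] n \<otimes> (a \<oplus> b)"
      by (simp flip: Suc.hyps(2))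
    also have "\<dots> = (a \<oplus> b) [^] n \<otimes> a \<oplus> (a \<oplus> b) [^] n \<otimes> b"
      using assms by (simp add: r_distr)
    also have "(a \<oplus> b) [^] n \<otimes> a = ((a [^] p') \<otimes> x \<oplus> (b [^] q) \<otimes> y) \<otimes> a"
      by (simp add: xy(5))
    also have "\<dots> = (a [^] p) \<otimes> x \<oplus> (b [^] q) \<otimes> (y \<otimes> a)"
      using assms xy(1-4) by (simp add: pq l_distr r_distr m_ac)
    also have "(a \<oplus> b) [^] n \<otimes> b = ((a [^] p) \<otimes> x' \<oplus> (b [^] q') \<otimes> y') \<otimes> b"
      by (simp add: xy(6))
    also have "\<dots> = (a [^] p) \<otimes> (x' \<otimes> b) \<oplus> (b [^] q) \<otimes> y'"
      using assms xy(1-4) by (simp add: pq l_distr r_distr m_ac)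
    also have "(a [^] p) \<otimes> x \<oplus> (b [^] q) \<otimes> (y \<otimes> a) \<oplus> ((a [^] p) \<otimes> (x' \<otimes> b) \<oplus> (b [^] q) \<otimes> y')
      = (a [^] p) \<otimes> (x \<oplus> x' \<otimes> b) \<oplus> (b [^] q) \<otimes> (y \<otimes> a \<oplus> y')"
      using assms xy by (simp add: r_distr a_ac)
    finally show ?thesis using assms xy by blast
  qed
qed

lemma nilradical_ideal: "ideal nilradical R"
proof (rule idealI[OF ring_axioms])
  have mult: "x \<otimes> a \<in> nilradical" if "a \<in> nilradical" "x \<in> carrier R" for a x
  proof -
    obtain n :: nat where "a [^] n = \<zero>" "a \<in> carrier R" using \<open>a \<in> nilradical\<close> by (auto simp: nilradical_def)
    then have "(x \<otimes> a) [^] n = \<zero>" using that(2) by (simp add: nat_pow_distrib)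
    then show ?thesis using that by (auto simp: nilradical_def)
  qed
  show "x \<otimes> a \<in> nilradical" "a \<otimes> x \<in> nilradical" if "a \<in> nilradical" "x \<in> carrier R" for a x
    using mult[OF that] that m_comm[of a x] by (auto simp: nilradical_def)
  show "subgroup nilradical (add_monoid R)"
  proof (rule add.subgroupI)
    show "nilradical \<subseteq> carrier R" by (auto simp: nilradical_def)
    have "\<zero> [^] (1::nat) = \<zero>" by simp
    then show "nilradical \<noteq> {}" unfolding nilradical_def by blast
    show "\<ominus> a \<in> nilradical" if "a \<in> nilradical" for a
    proof -
      have "\<ominus> a = (\<ominus> \<one>) \<otimes> a" using that by (simp add: nilradical_def l_minus)
      then show ?thesis using mult[OF that, of "\<ominus> \<one>"] by simp
    qed
    show "a \<oplus> b \<in> nilradical" if ab: "a \<in> nilradical" "b \<in> nilradical" for a b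
    proof -
      have car: "a \<in> carrier R" "b \<in> carrier R" using ab by (auto simp: nilradical_def)
      obtain p q :: nat where "a [^] p = \<zero>" "b [^] q = \<zero>" using ab by (auto simp: nilradical_def)
      then have "(a \<oplus> b) [^] (p + q) = \<zero>" using add_pow_decomp[OF car, of p q] by auto
      then show ?thesis using car by (auto simp: nilradical_def)
    qed
  qed
qed

lemma primeideal_pow:
  assumes "primeideal P R" "a \<in> carrier R" "a [^] (n::nat) \<in> P"
  shows "a \<in> P"
  using assms(3)
proof (induction n)
  case 0
  interpret primeideal P R by fact
  have "P = carrier R" using 0 by (intro one_imp_carrier) simp
  then show ?case using I_notcarr by simp
next
  case (Suc n)
  interpret primeideal P R by fact
  show ?case using Suc I_prime[of "a [^] n" a] assms(2) by auto
qed

lemma nilradical_subset_primeideal: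
  assumes "primeideal P R"
  shows "nilradical \<subseteq> P"
proof
  fix a assume "a \<in> nilradical"
  then obtain n :: nat where "a \<in> carrier R" "a [^] n = \<zero>" by (auto simp: nilradical_def)
  moreover have "\<zero> \<in> P"
    using additive_subgroup.zero_closed[OF ideal.axioms(1)[OF primeideal.axioms(1)[OF assms]]] .
  ultimately show "a \<in> P" using primeideal_pow[OF assms, of a n] by simp
qed

end

section \<open>Modules over k[x]\<close>

locale poly_algebra = cring R for R (structure) +
  fixes \<iota> :: "'k::field poly \<Rightarrow> 'a"
  assumes iota_closed [simp, intro]: "\<iota> f \<in> carrier R"
    and iota_add: "\<iota> (f + g) = \<iota> f \<oplus> \<iota> g"
    and iota_mult: "\<iota> (f * g) = \<iota> f \<otimes> \<iota> g"
    and iota_one [simp]: "\<iota> 1 = \<one>"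
begin

lemma iota_zero [simp]: "\<iota> 0 = \<zero>"
proof -
  have "\<iota> 0 \<oplus> \<iota> 0 = \<iota> 0" using iota_add[of 0 0] by simp
  then show ?thesis by (metis add.r_cancel_one' iota_closed)
qed

lemma iota_minus: "\<iota> (- f) = \<ominus> \<iota> f"
proof -
  have "\<iota> (- f) \<oplus> \<iota> f = \<zero>" using iota_add[of "- f" f] by simp
  then show ?thesis by (metis iota_closed minus_equality)
qed

lemma iota_pow: "\<iota> (f ^ n) = \<iota> f [^] n"
  by (induction n) (auto simp: iota_mult m_comm)

text \<open>The recursion splits off the first coefficient, as the induction in
  \<open>submodule_finitely_generated\<close> requires.\<close>

fun span :: "'a list \<Rightarrow> 'a set" where
  "span [] = {\<zero>}"
| "span (b # bs) = {\<iota> f \<otimes> b \<oplus> y | f y. y \<in> span bs}"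

definition submodule :: "'a set \<Rightarrow> bool" where
  "submodule M \<longleftrightarrow> M \<subseteq> carrier R \<and> \<zero> \<in> M \<and> (\<forall>x\<in>M. \<forall>y\<in>M. x \<oplus> y \<in> M) \<and> (\<forall>f. \<forall>x\<in>M. \<iota> f \<otimes> x \<in> M)"

lemma span_ConsI: "y \<in> span bs \<Longrightarrow> x = \<iota> f \<otimes> b \<oplus> y \<Longrightarrow> x \<in> span (b # bs)"
  by auto

lemma submodule_span:
  assumes "set bs \<subseteq> carrier R"
  shows "submodule (span bs)"
  using assms
proof (induction bs)
  case Nil
  then show ?case by (simp add: submodule_def)
next
  case (Cons b bs)
  then have M: "submodule (span bs)" and b: "b \<in> carrier R" by auto
  have carr: "y \<in> carrier R" if "y \<in> span bs" for y using that M by (auto simp: submodule_def)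
  show ?case
    unfolding submodule_def
  proof (intro conjI ballI allI subsetI)
    show "x \<in> carrier R" if "x \<in> span (b # bs)" for x using that b carr by auto
    have "\<zero> = \<iota> 0 \<otimes> b \<oplus> \<zero>" "\<zero> \<in> span bs" using b M by (auto simp: submodule_def)
    then show "\<zero> \<in> span (b # bs)" by (intro span_ConsI)
  next
    fix x y assume "x \<in> span (b # bs)" "y \<in> span (b # bs)"
    then obtain f x' g y' where *: "x = \<iota> f \<otimes> b \<oplus> x'" "y = \<iota> g \<otimes> b \<oplus> y'" "x' \<in> span bs" "y' \<in> span bs" by auto
    then have "x \<oplus> y = \<iota> (f + g) \<otimes> b \<oplus> (x' \<oplus> y')"
      using b carr by (simp add: iota_add l_distr a_ac)
    moreover have "x' \<oplus> y' \<in> span bs" using * M by (auto simp: submodule_def)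
    ultimately show "x \<oplus> y \<in> span (b # bs)" by auto
  next
    fix f x assume "x \<in> span (b # bs)"
    then obtain g x' where *: "x = \<iota> g \<otimes> b \<oplus> x'" "x' \<in> span bs" by auto
    then have "\<iota> f \<otimes> x = \<iota> (f * g) \<otimes> b \<oplus> \<iota> f \<otimes> x'"
      using b carr by (simp add: iota_mult r_distr m_assoc)
    moreover have "\<iota> f \<otimes> x' \<in> span bs" using * M by (auto simp: submodule_def)
    ultimately show "\<iota> f \<otimes> x \<in> span (b # bs)" by auto
  qed
qed

lemma span_mem:
  assumes "set bs \<subseteq> carrier R" "b \<in> set bs"
  shows "b \<in> span bs"
  using assms
proof (induction bs)
  case (Cons a bs)
  show ?case
  proof (cases "b \<in> set bs")
    case True
    then have "b = \<iota> 0 \<otimes> a \<oplus> b" "b \<in> span bs" using Cons by auto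
    then show ?thesis by (intro span_ConsI)
  next
    case False
    then have "b = \<iota> 1 \<otimes> a \<oplus> \<zero>" "\<zero> \<in> span bs"
      using Cons submodule_span[of bs] by (auto simp: submodule_def)
    then show ?thesis by (intro span_ConsI)
  qed
qed simp

lemma span_subset_submodule:
  assumes "submodule M" "set bs \<subseteq> M"
  shows "span bs \<subseteq> M"
  using assms(2)
proof (induction bs)
  case (Cons b bs)
  have "\<iota> f \<otimes> b \<oplus> y \<in> M" if "y \<in> span bs" for f y
    using that Cons assms(1) by (auto simp: submodule_def)
  then show ?case by auto
qed (use assms in \<open>simp add: submodule_def\<close>)

text \<open>The classical argument over a principal ideal domain: the first coefficients of the
  elements of \<open>M\<close> form an ideal generated by some \<open>p\<close>, lifted to
  \<open>a \<in> M\<close>. Subtracting a multiple of \<open>a\<close> moves any element of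
  \<open>M\<close> into \<open>M \<inter> span bs\<close>, where the induction hypothesis
  applies.\<close>

lemma submodule_finitely_generated:
  assumes "set bs \<subseteq> carrier R" "submodule M" "M \<subseteq> span bs"
  shows "\<exists>as. set as \<subseteq> M \<and> M = span as"
  using assms
proof (induction bs arbitrary: M)
  case Nil
  then have "M = span []" by (auto simp: submodule_def)
  then show ?case by (intro exI[of _ "[]"]) simp
next
  case (Cons b bs)
  have b: "b \<in> carrier R" and bs: "set bs \<subseteq> carrier R" using Cons.prems by auto
  note S = submodule_span[OF bs, unfolded submodule_def]
  note M = Cons.prems(2)[unfolded submodule_def]
  \<comment> \<open>Coefficients need not be unique, so \<open>K\<close> collects those of all
    representations.\<close>
  define K where "K = {f. \<exists>y\<in>span bs. \<iota> f \<otimes> b \<oplus> y \<in> M}"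
  have "\<exists>p\<in>K. \<forall>f\<in>K. p dvd f"
  proof (rule poly_ideal_principal)
    have "\<iota> 0 \<otimes> b \<oplus> \<zero> \<in> M" "\<zero> \<in> span bs" using b S M by auto
    then show "0 \<in> K" unfolding K_def by blast
  next
    fix f g assume "f \<in> K" "g \<in> K"
    then obtain x y where *: "x \<in> span bs" "y \<in> span bs" "\<iota> f \<otimes> b \<oplus> x \<in> M" "\<iota> g \<otimes> b \<oplus> y \<in> M"
      unfolding K_def by blast
    have "x \<in> carrier R" "y \<in> carrier R" using * S by auto
    then have "\<iota> (f + g) \<otimes> b \<oplus> (x \<oplus> y) = (\<iota> f \<otimes> b \<oplus> x) \<oplus> (\<iota> g \<otimes> b \<oplus> y)"
      using b by (simp add: iota_add l_distr a_ac)
    also have "\<dots> \<in> M" using * M by blast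
    finally show "f + g \<in> K" unfolding K_def using * S by blast
  next
    fix f g assume "f \<in> K"
    then obtain x where *: "x \<in> span bs" "\<iota> f \<otimes> b \<oplus> x \<in> M" unfolding K_def by blast
    have "x \<in> carrier R" using * S by auto
    then have "\<iota> (g * f) \<otimes> b \<oplus> (\<iota> g \<otimes> x) = \<iota> g \<otimes> (\<iota> f \<otimes> b \<oplus> x)"
      using b by (simp add: iota_mult r_distr m_assoc)
    also have "\<dots> \<in> M" using * M by blast
    finally show "g * f \<in> K" unfolding K_def using * S by blast
  qed
  then obtain p where p: "p \<in> K" "\<And>f. f \<in> K \<Longrightarrow> p dvd f" by blast
  then obtain y where y: "y \<in> span bs" "\<iota> p \<otimes> b \<oplus> y \<in> M" unfolding K_def by blast
  define a where "a = \<iota> p \<otimes> b \<oplus> y"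
  have yc: "y \<in> carrier R" using y S by auto
  have "submodule (M \<inter> span bs)" using S M unfolding submodule_def by blast
  then obtain as where as: "set as \<subseteq> M \<inter> span bs" "M \<inter> span bs = span as"
    using Cons.IH[OF bs] by blast
  have "M \<subseteq> span (a # as)"
  proof
    fix z assume z: "z \<in> M"
    then obtain f x where x: "z = \<iota> f \<otimes> b \<oplus> x" "x \<in> span bs" using Cons.prems(3) by auto
    then have "f \<in> K" using z unfolding K_def by blast
    then obtain q where q: "f = p * q" using p(2) by (metis dvdE)
    have xc: "x \<in> carrier R" using x S by auto
    define w where "w = z \<oplus> \<iota> (- q) \<otimes> a"
    have "w \<in> M" using z y M unfolding w_def a_def by blast
    have w: "w = x \<oplus> \<iota> (- q) \<otimes> y"
    proof -
      have "\<iota> (- q) \<otimes> (\<iota> p \<otimes> b) = \<ominus> (\<iota> f \<otimes> b)"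
        using b by (simp add: q iota_minus iota_mult l_minus m_assoc[symmetric] m_comm[of "\<iota> q"])
      then have "w = \<iota> f \<otimes> b \<oplus> x \<oplus> (\<ominus> (\<iota> f \<otimes> b) \<oplus> \<iota> (- q) \<otimes> y)"
        unfolding w_def a_def x using b yc by (simp add: r_distr)
      also have "\<dots> = (\<iota> f \<otimes> b \<oplus> \<ominus> (\<iota> f \<otimes> b)) \<oplus> (x \<oplus> \<iota> (- q) \<otimes> y)"
        using b xc yc by (simp only: a_ac m_closed iota_closed a_closed a_inv_closed)
      finally show ?thesis using b xc yc by (simp add: r_neg)
    qed
    then have "w \<in> span bs" using x y S by blast
    then have "w \<in> span as" using \<open>w \<in> M\<close> as by blast
    moreover have "z = \<iota> q \<otimes> a \<oplus> w"
    proof -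
      have ac: "a \<in> carrier R" "z \<in> carrier R" using y z M unfolding a_def by auto
      have "\<iota> q \<otimes> a \<oplus> w = z \<oplus> (\<iota> q \<otimes> a \<oplus> \<ominus> (\<iota> q \<otimes> a))"
        unfolding w_def using ac by (simp add: iota_minus l_minus a_ac)
      then show ?thesis using ac by (simp add: r_neg)
    qed
    ultimately show "z \<in> span (a # as)" by auto
  qed
  moreover have sub: "set (a # as) \<subseteq> M" using as y by (auto simp: a_def)
  ultimately have "M = span (a # as)" using span_subset_submodule[OF Cons.prems(2) sub] by blast
  then show ?case using sub by blast
qed

lemma ideal_submodule:
  assumes "ideal I R"
  shows "submodule I"
proof -
  interpret ideal I R by fact
  show ?thesis using a_subset I_l_closed by (auto simp: submodule_def)
qed

text \<open>Generators of an ideal as a k[x]-module also generate it as an ideal.\<close>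

lemma noetherian:
  assumes "set bs \<subseteq> carrier R" "carrier R = span bs"
  shows "noetherian_ring R"
proof (rule noetherian_ringI)
  fix I assume I: "ideal I R"
  have Ic: "I \<subseteq> carrier R" using ideal_submodule[OF I] by (simp add: submodule_def)
  then obtain as where as: "set as \<subseteq> I" "I = span as"
    using submodule_finitely_generated[OF assms(1) ideal_submodule[OF I]] assms(2) by blast
  have ac: "set as \<subseteq> carrier R" using as(1) Ic by blast
  have "span as \<subseteq> Idl (set as)"
    using ideal_submodule[OF genideal_ideal[OF ac]] genideal_self[OF ac] by (rule span_subset_submodule)
  moreover have "Idl (set as) \<subseteq> I" using I as(1) by (rule genideal_minimal)
  ultimately show "\<exists>A\<subseteq>carrier R. finite A \<and> I = Idl A" using as(2) ac by (intro exI[of _ "set as"]) auto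
qed

lemma contraction_principal:
  assumes "ideal P R"
  shows "\<exists>p. \<iota> p \<in> P \<and> (\<forall>f. \<iota> f \<in> P \<longrightarrow> p dvd f)"
proof -
  interpret ideal P R by fact
  have "\<exists>p\<in>{f. \<iota> f \<in> P}. \<forall>f\<in>{f. \<iota> f \<in> P}. p dvd f"
    by (rule poly_ideal_principal) (auto simp: iota_add iota_mult I_l_closed)
  then show ?thesis by auto
qed

end

section \<open>Primes, height and depth of a nilpotent extension\<close>

lemma (in ring) genideal_empty: "Idl {} = {\<zero>}"
proof
  show "Idl {} \<subseteq> {\<zero>}" by (intro genideal_minimal zeroideal) simp
  have "additive_subgroup (Idl {}) R" by (intro ideal.axioms(1) genideal_ideal) simp
  then show "{\<zero>} \<subseteq> Idl {}" using additive_subgroup.zero_closed by blast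
qed

text \<open>Modulo nilpotent elements such a ring is the polynomial ring in one variable, so its prime
  spectrum is that of \<open>k[x]\<close>.\<close>

locale nilpotent_extension = poly_algebra R \<iota> for R (structure) and \<iota> :: "'k::field poly \<Rightarrow> 'a" +
  fixes bs :: "'a list"
  assumes bs_nil: "set bs \<subseteq> nilradical"
    and carrier_span: "carrier R = span (\<one> # bs)"
    and iota_regular: "\<lbrakk>f \<noteq> 0; r \<in> carrier R; \<iota> f \<otimes> r = \<zero>\<rbrakk> \<Longrightarrow> r = \<zero>"
begin

lemma decompose:
  assumes "a \<in> carrier R"
  obtains f u where "u \<in> nilradical" "a = \<iota> f \<oplus> u"
proof -
  have "a \<in> span (\<one> # bs)" using assms by (simp only: carrier_span)
  then obtain f u where *: "a = \<iota> f \<otimes> \<one> \<oplus> u" "u \<in> span bs" by auto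
  then have "u \<in> nilradical"
    using span_subset_submodule[OF ideal_submodule[OF nilradical_ideal] bs_nil] by blast
  moreover have "\<iota> f \<otimes> \<one> = \<iota> f" by simp
  ultimately show ?thesis using that * by metis
qed

lemma nilradical_carrier: "u \<in> nilradical \<Longrightarrow> u \<in> carrier R"
  by (simp add: nilradical_def)

lemma decompose_mem_prime:
  assumes "primeideal P R" "u \<in> nilradical"
  shows "\<iota> f \<oplus> u \<in> P \<longleftrightarrow> \<iota> f \<in> P"
proof -
  interpret primeideal P R by fact
  have u: "u \<in> P" using nilradical_subset_primeideal[OF assms(1)] assms(2) by blast
  have "\<iota> f = (\<iota> f \<oplus> u) \<oplus> \<ominus> u"
    using nilradical_carrier[OF assms(2)] by (simp add: a_assoc r_neg)
  then show ?thesis using u by (metis a_closed a_inv_closed)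
qed

text \<open>For \<open>f \<noteq> 0\<close> the power \<open>f ^ n\<close> is again nonzero, hence
  regular, and cannot annihilate \<open>\<one>\<close>. The zero ring satisfies the locale
  assumptions, so it is excluded here; any prime ideal guarantees
  \<open>\<one> \<noteq> \<zero>\<close>.\<close>

lemma iota_nilpotent:
  assumes "\<one> \<noteq> \<zero>" "\<iota> f \<in> nilradical"
  shows "f = 0"
proof (rule ccontr)
  assume f: "f \<noteq> 0"
  obtain n :: nat where "\<iota> f [^] n = \<zero>" using assms(2) by (auto simp: nilradical_def)
  then have "\<iota> (f ^ n) \<otimes> \<one> = \<zero>" by (simp add: iota_pow)
  then show False using iota_regular[of "f ^ n" \<one>] f assms(1) by simp
qed

lemma primeideal_one_neq_zero:
  assumes "primeideal P R"
  shows "\<one> \<noteq> \<zero>" "\<one> \<notin> P"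
proof -
  interpret primeideal P R by fact
  show "\<one> \<notin> P" using one_imp_carrier I_notcarr by blast
  then show "\<one> \<noteq> \<zero>" using zero_closed by auto
qed

text \<open>Modulo nilpotents the product of \<open>a\<close> and \<open>b\<close> is
  \<open>\<iota> (f * g)\<close>. If this is nilpotent, then \<open>f * g = 0\<close> and one of the
  two polynomial parts vanishes.\<close>

lemma nilradical_prime:
  assumes "\<one> \<noteq> \<zero>"
  shows "primeideal nilradical R"
proof (rule primeidealI[OF nilradical_ideal is_cring])
  interpret N: ideal nilradical R by (rule nilradical_ideal)
  show "carrier R \<noteq> nilradical" using iota_nilpotent[OF assms, of 1] by auto
  fix a b assume ab: "a \<in> carrier R" "b \<in> carrier R" "a \<otimes> b \<in> nilradical"
  obtain f u where a: "u \<in> nilradical" "a = \<iota> f \<oplus> u" using decompose[OF ab(1)] .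
  obtain g v where b: "v \<in> nilradical" "b = \<iota> g \<oplus> v" using decompose[OF ab(2)] .
  have uv: "u \<in> carrier R" "v \<in> carrier R" using a b nilradical_carrier by auto
  define w where "w = u \<otimes> b \<oplus> \<iota> f \<otimes> v"
  have w: "w \<in> nilradical" unfolding w_def using a b ab N.I_l_closed N.I_r_closed by auto
  have "a \<otimes> b = \<iota> f \<otimes> b \<oplus> u \<otimes> b" unfolding a(2) using ab(2) uv by (simp add: l_distr)
  also have "\<iota> f \<otimes> b = \<iota> (f * g) \<oplus> \<iota> f \<otimes> v" unfolding b(2) using uv by (simp add: r_distr iota_mult)
  also have "\<iota> (f * g) \<oplus> \<iota> f \<otimes> v \<oplus> u \<otimes> b = \<iota> (f * g) \<oplus> w"
    unfolding w_def using uv ab by (simp add: a_ac)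
  finally have eq: "a \<otimes> b = \<iota> (f * g) \<oplus> w" .
  have "\<iota> (f * g) = a \<otimes> b \<oplus> \<ominus> w" unfolding eq using nilradical_carrier[OF w] by (simp add: a_assoc r_neg)
  then have "\<iota> (f * g) \<in> nilradical" using ab w by simp
  then have "f * g = 0" by (rule iota_nilpotent[OF assms])
  then show "a \<in> nilradical \<or> b \<in> nilradical" using a b uv by auto
qed

text \<open>The contractions of \<open>P\<close> and \<open>Q\<close> to k[x] are generated by
  \<open>p\<close> and \<open>q\<close> with \<open>p = q * r\<close>. Here
  \<open>p \<noteq> 0\<close>, as otherwise all elements of \<open>P\<close> would be nilpotent and
  lie in \<open>C\<close>. Since \<open>\<iota> q\<close> is not in \<open>P\<close>, primality puts
  \<open>\<iota> r\<close> into \<open>P\<close>, so \<open>p\<close> divides \<open>r\<close> and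
  \<open>q\<close> is a unit, contradicting that \<open>Q\<close> is proper.\<close>

lemma no_prime_chain:
  assumes "primeideal C R" "primeideal P R" "primeideal Q R" "C \<subset> P" "P \<subset> Q"
  shows False
proof -
  interpret C: primeideal C R by fact
  interpret P: primeideal P R by fact
  interpret Q: primeideal Q R by fact
  obtain a where a: "a \<in> P" "a \<notin> C" using assms(4) by blast
  obtain f u where f: "u \<in> nilradical" "a = \<iota> f \<oplus> u" using decompose[OF P.Icarr[OF a(1)]] .
  have fP: "\<iota> f \<in> P" using a f decompose_mem_prime[OF assms(2)] by simp
  have "f \<noteq> 0" using a f nilradical_subset_primeideal[OF assms(1)] nilradical_carrier by auto
  obtain b where b: "b \<in> Q" "b \<notin> P" using assms(5) by blast
  obtain g v where g: "v \<in> nilradical" "b = \<iota> g \<oplus> v" using decompose[OF Q.Icarr[OF b(1)]] .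
  have gQ: "\<iota> g \<in> Q" "\<iota> g \<notin> P"
    using b g decompose_mem_prime[OF assms(2)] decompose_mem_prime[OF assms(3)] by auto
  obtain p where p: "\<iota> p \<in> P" "\<And>f. \<iota> f \<in> P \<Longrightarrow> p dvd f"
    using contraction_principal[OF P.is_ideal] by blast
  obtain q where q: "\<iota> q \<in> Q" "\<And>f. \<iota> f \<in> Q \<Longrightarrow> q dvd f"
    using contraction_principal[OF Q.is_ideal] by blast
  have "p \<noteq> 0" using p(2)[OF fP] \<open>f \<noteq> 0\<close> by auto
  have "q dvd p" using q(2) p(1) assms(5) by blast
  then obtain r where r: "p = q * r" by (rule dvdE)
  have "\<iota> q \<notin> P"
  proof
    assume "\<iota> q \<in> P"
    moreover obtain s where "g = q * s" using q(2)[OF gQ(1)] by (rule dvdE)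
    ultimately show False using gQ(2) by (simp add: iota_mult P.I_r_closed)
  qed
  then have "\<iota> r \<in> P" using P.I_prime[of "\<iota> q" "\<iota> r"] p(1) r by (simp add: iota_mult)
  then obtain s where "r = p * s" using p(2) by (meson dvdE)
  then have "p * (q * s) = p * 1" using r by (simp add: algebra_simps)
  then have "q * s = 1" using \<open>p \<noteq> 0\<close> mult_left_cancel by blast
  then have "\<one> = \<iota> q \<otimes> \<iota> s" by (simp flip: iota_mult)
  then have "\<one> \<in> Q" using q(1) by (simp add: Q.I_r_closed)
  then show False using primeideal_one_neq_zero(2)[OF assms(3)] by simp
qed

text \<open>Were they equal, the variable \<open>\<xi>\<close> would be invertible modulo
  nilpotents, and comparing polynomial parts would give \<open>\<xi> dvd 1\<close> in k[x].\<close>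

lemma nilradical_psubset_maximal:
  assumes "maximalideal P R"
  shows "nilradical \<subset> P"
proof (rule psubsetI)
  have P: "primeideal P R" using assms by (rule maximalideal_prime)
  show "nilradical \<subseteq> P" using P by (rule nilradical_subset_primeideal)
  have ne: "\<one> \<noteq> \<zero>" using P by (rule primeideal_one_neq_zero)
  show "nilradical \<noteq> P"
  proof
    assume eq: "nilradical = P"
    interpret maximalideal P R by fact
    define \<xi> :: "'k poly" where "\<xi> = [:0, 1:]"
    have \<xi>: "\<iota> \<xi> \<notin> P" using iota_nilpotent[OF ne, of \<xi>] eq by (auto simp: \<xi>_def)
    define J where "J = P <+>\<^bsub>R\<^esub> PIdl (\<iota> \<xi>)"
    have J: "ideal J R" unfolding J_def by (intro add_ideals cgenideal_ideal is_ideal) simp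
    have Jmem: "J = {x \<oplus> r \<otimes> \<iota> \<xi> | x r. x \<in> P \<and> r \<in> carrier R}"
      unfolding J_def set_add_def' cgenideal_def by blast
    have "x \<in> J" if "x \<in> P" for x
    proof -
      have "x = x \<oplus> \<zero> \<otimes> \<iota> \<xi>" using that Icarr by simp
      then show ?thesis unfolding Jmem using that by blast
    qed
    moreover have "\<iota> \<xi> \<in> J"
    proof -
      have "\<iota> \<xi> = \<zero> \<oplus> \<one> \<otimes> \<iota> \<xi>" by simp
      then show ?thesis unfolding Jmem using zero_closed by blast
    qed
    moreover have "J \<subseteq> carrier R" using ideal_submodule[OF J] by (simp add: submodule_def)
    ultimately have "J = carrier R" using I_maximal[OF J] \<xi> by blast
    then have "\<one> \<in> J" by simp
    then obtain x r where x: "x \<in> P" "r \<in> carrier R" "\<one> = x \<oplus> r \<otimes> \<iota> \<xi>" unfolding Jmem by blast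
    obtain g v where g: "v \<in> nilradical" "r = \<iota> g \<oplus> v" using decompose[OF x(2)] .
    have vx: "v \<in> carrier R" "x \<in> carrier R" using g x nilradical_carrier Icarr by auto
    have "r \<otimes> \<iota> \<xi> = \<iota> (g * \<xi>) \<oplus> v \<otimes> \<iota> \<xi>" unfolding g(2) using vx by (simp add: l_distr iota_mult)
    then have one: "\<one> = \<iota> (g * \<xi>) \<oplus> (x \<oplus> v \<otimes> \<iota> \<xi>)" using x(3) vx by (simp add: a_ac)
    have "x \<oplus> v \<otimes> \<iota> \<xi> \<in> P" using x(1) g(1) eq I_r_closed by auto
    moreover have "\<iota> (1 - g * \<xi>) = x \<oplus> v \<otimes> \<iota> \<xi>"
    proof -
      have "\<iota> (1 - g * \<xi>) = \<one> \<oplus> \<ominus> \<iota> (g * \<xi>)" using iota_add[of 1 "- (g * \<xi>)"] by (simp add: iota_minus)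
      also have "\<dots> = (\<iota> (g * \<xi>) \<oplus> \<ominus> \<iota> (g * \<xi>)) \<oplus> (x \<oplus> v \<otimes> \<iota> \<xi>)"
        unfolding one using vx by (simp add: a_ac del: r_neg)
      finally show ?thesis using vx by (simp add: r_neg)
    qed
    ultimately have "\<iota> (1 - g * \<xi>) \<in> nilradical" unfolding eq by (simp only:)
    then have "1 - g * \<xi> = 0" by (rule iota_nilpotent[OF ne])
    then have "\<xi> dvd 1" by (metis dvd_triv_right eq_iff_diff_eq_0)
    then show False by (simp add: \<xi>_def is_unit_iff_degree)
  qed
qed

lemma height_maximal:
  assumes "maximalideal P R"
  shows "height R P = 1"
proof -
  have P: "primeideal P R" using assms by (rule maximalideal_prime)
  have ne: "\<one> \<noteq> \<zero>" using P by (rule primeideal_one_neq_zero)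
  let ?S = "{n. \<exists>C. (\<forall>i\<le>n. primeideal (C i) R) \<and> (\<forall>i<n. C i \<subset> C (Suc i)) \<and> C n = P}"
  have "n \<le> 1" if n: "n \<in> ?S" for n
  proof (rule ccontr)
    assume "\<not> n \<le> 1"
    moreover obtain C where C: "\<forall>i\<le>n. primeideal (C i) R" "\<forall>i<n. C i \<subset> C (Suc i)"
      using n by blast
    ultimately show False
      using no_prime_chain[of "C 0" "C (Suc 0)" "C (Suc (Suc 0))"] by auto
  qed
  moreover have "1 \<in> ?S"
    using P nilradical_prime[OF ne] nilradical_psubset_maximal[OF assms]
    by (intro CollectI exI[of _ "\<lambda>i. if i = 0 then nilradical else P"]) auto
  ultimately show ?thesis unfolding height_def
    by (intro antisym SUP_least SUP_upper2[of 1]) (auto simp: one_enat_def)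
qed

lemma regular_singleton:
  assumes "primeideal P R" "\<iota> f \<in> P" "f \<noteq> 0"
  shows "regular_sequence R [\<iota> f]"
proof -
  interpret P: primeideal P R by fact
  have "Idl {\<iota> f} \<subseteq> P" using assms(2) by (intro genideal_minimal P.is_ideal) simp
  then have "Idl {\<iota> f} \<noteq> carrier R" using P.I_notcarr P.a_subset by auto
  then show ?thesis using iota_regular[OF assms(3)]
    by (auto simp: regular_sequence_def genideal_empty)
qed

text \<open>Modulo the first element \<open>y1\<close>, the second element \<open>y2\<close> raised to a power kills some \<open>u\<close>
  outside \<open>P\<close>: take a polynomial \<open>u\<close> of least degree for which \<open>f1\<close> divides \<open>f2 ^ a * u\<close>.\<close>

lemma regular_sequence_length_le:
  assumes "primeideal P R" "regular_sequence R ys" "set ys \<subseteq> P"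
  shows "length ys \<le> 1"
proof (rule ccontr)
  assume len: "\<not> length ys \<le> 1"
  interpret P: primeideal P R by fact
  have ne: "\<one> \<noteq> \<zero>" using assms(1) by (rule primeideal_one_neq_zero)
  define y1 y2 where "y1 = ys ! 0" and "y2 = ys ! 1"
  have yP: "y1 \<in> P" "y2 \<in> P"
    unfolding y1_def y2_def using len by (auto intro!: subsetD[OF assms(3)] nth_mem)
  have yc: "y1 \<in> carrier R" "y2 \<in> carrier R" using yP P.Icarr by auto
  have "take 1 ys = [y1]" using len by (cases ys) (auto simp: y1_def)
  then have reg2: "y2 \<otimes> r \<in> PIdl y1 \<Longrightarrow> r \<in> PIdl y1" if "r \<in> carrier R" for r
    using assms(2) len that cgenideal_eq_genideal[OF yc(1)]
    unfolding regular_sequence_def y2_def by (auto dest!: spec[of _ 1])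
  have reg1: "r = \<zero>" if "r \<in> carrier R" "y1 \<otimes> r = \<zero>" for r
    using assms(2) len that
    unfolding regular_sequence_def y1_def by (auto simp: genideal_empty dest!: spec[of _ 0])
  obtain f1 u1 where f1: "u1 \<in> nilradical" "y1 = \<iota> f1 \<oplus> u1" using decompose[OF yc(1)] .
  obtain f2 u2 where f2: "u2 \<in> nilradical" "y2 = \<iota> f2 \<oplus> u2" using decompose[OF yc(2)] .
  have uc: "u1 \<in> carrier R" "u2 \<in> carrier R" using f1 f2 nilradical_carrier by auto
  have fP: "\<iota> f1 \<in> P" "\<iota> f2 \<in> P" using decompose_mem_prime[OF assms(1)] f1 f2 yP by auto
  have "f1 \<noteq> 0"
  proof
    assume "f1 = 0"
    then have "y1 \<in> nilradical" using f1 uc by simp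
    then obtain n :: nat where n: "y1 [^] n = \<zero>" by (auto simp: nilradical_def)
    \<comment> \<open>A nonzerodivisor of a nonzero ring is not nilpotent.\<close>
    have "y1 [^] n \<noteq> \<zero>" for n :: nat
    proof (induction n)
      case (Suc n)
      then show ?case using reg1[of "y1 [^] n"] yc by (auto simp: m_comm)
    qed (use ne in simp)
    with n show False by blast
  qed
  obtain p where p: "\<iota> p \<in> P" "\<And>f. \<iota> f \<in> P \<Longrightarrow> p dvd f"
    using contraction_principal[OF P.is_ideal] by blast
  have "p \<noteq> 0" using p(2)[OF fP(1)] \<open>f1 \<noteq> 0\<close> by auto
  have "\<not> p dvd 1"
  proof
    assume "p dvd 1"
    then obtain s where "1 = p * s" by (rule dvdE)
    then have "\<one> = \<iota> p \<otimes> \<iota> s" by (metis iota_mult iota_one)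
    then show False using primeideal_one_neq_zero(2)[OF assms(1)] p(1) P.I_r_closed by simp
  qed
  then have "Polynomial.degree p > 0" using \<open>p \<noteq> 0\<close> by (simp add: is_unit_iff_degree)
  define Q where "Q = (\<lambda>u. u \<noteq> 0 \<and> (\<exists>a. f1 dvd f2 ^ a * u))"
  have "Q f1" using \<open>f1 \<noteq> 0\<close> by (simp add: Q_def)
  define u where "u = arg_min Polynomial.degree Q"
  have "Q u" unfolding u_def using \<open>Q f1\<close> by (rule arg_min_natI)
  have umin: "Polynomial.degree u \<le> Polynomial.degree v" if "Q v" for v
    unfolding u_def using that by (rule arg_min_nat_le)
  obtain a where a: "f1 dvd f2 ^ a * u" using \<open>Q u\<close> by (auto simp: Q_def)
  \<comment> \<open>Since \<open>p\<close> also divides \<open>f2\<close>, a factor \<open>p\<close>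
    of \<open>u\<close> could be absorbed into one more power of \<open>f2\<close>, leaving a
    cofactor of smaller degree.\<close>
  have "\<not> p dvd u"
  proof
    assume "p dvd u"
    then obtain v where v: "u = p * v" by (rule dvdE)
    obtain w where w: "f2 = p * w" using p(2)[OF fP(2)] by (rule dvdE)
    have "f2 ^ Suc a * v = f2 ^ a * (p * w) * v" by (simp add: w mult.commute)
    also have "\<dots> = (f2 ^ a * u) * w" by (simp add: v mult_ac)
    finally have "f1 dvd f2 ^ Suc a * v" using dvd_mult2[OF a, of w] by (simp only:)
    moreover have "v \<noteq> 0" using \<open>Q u\<close> v by (auto simp: Q_def)
    ultimately have "Q v" unfolding Q_def by blast
    then have "Polynomial.degree u \<le> Polynomial.degree v" by (rule umin)
    moreover have "Polynomial.degree u = Polynomial.degree p + Polynomial.degree v"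
      using v \<open>p \<noteq> 0\<close> \<open>v \<noteq> 0\<close> by (simp add: degree_mult_eq)
    ultimately show False using \<open>Polynomial.degree p > 0\<close> by simp
  qed
  then have uP: "\<iota> u \<notin> P" using p(2) by blast
  obtain w where w: "f2 ^ a * u = f1 * w" using a by (rule dvdE)
  interpret N: ideal nilradical R by (rule nilradical_ideal)
  have "\<exists>v\<in>nilradical. y2 [^] a = \<iota> (f2 ^ a) \<oplus> v"
  proof (induction a)
    case 0
    show ?case by (intro bexI[of _ \<zero>]) auto
  next
    case (Suc a)
    then obtain v where v: "v \<in> nilradical" "y2 [^] a = \<iota> (f2 ^ a) \<oplus> v" by blast
    note vc = nilradical_carrier[OF v(1)]
    have "y2 [^] Suc a = (\<iota> (f2 ^ a) \<oplus> v) \<otimes> (\<iota> f2 \<oplus> u2)" using v f2 by simp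
    also have "\<dots> = \<iota> (f2 ^ a) \<otimes> (\<iota> f2 \<oplus> u2) \<oplus> v \<otimes> (\<iota> f2 \<oplus> u2)"
      using uc vc by (intro l_distr) auto
    also have "\<iota> (f2 ^ a) \<otimes> (\<iota> f2 \<oplus> u2) = \<iota> (f2 ^ Suc a) \<oplus> \<iota> (f2 ^ a) \<otimes> u2"
      using uc by (simp only: r_distr iota_closed power_Suc2 iota_mult)
    also have "\<dots> \<oplus> v \<otimes> (\<iota> f2 \<oplus> u2) = \<iota> (f2 ^ Suc a) \<oplus> (\<iota> (f2 ^ a) \<otimes> u2 \<oplus> v \<otimes> (\<iota> f2 \<oplus> u2))"
      using uc vc by (intro a_assoc) auto
    finally have "y2 [^] Suc a = \<dots>" .
    moreover have "\<iota> (f2 ^ a) \<otimes> u2 \<oplus> v \<otimes> (\<iota> f2 \<oplus> u2) \<in> nilradical"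
      using v(1) f2(1) uc by (intro N.a_closed N.I_l_closed N.I_r_closed) auto
    ultimately show ?case by (rule rev_bexI[rotated])
  qed
  then obtain v where v: "v \<in> nilradical" "y2 [^] a = \<iota> (f2 ^ a) \<oplus> v" by blast
  note vc = nilradical_carrier[OF v(1)]
  \<comment> \<open>\<open>z\<close> is the nilpotent error made by replacing \<open>f1\<close> and
    \<open>f2 ^ a\<close> by \<open>y1\<close> and \<open>y2 ^ a\<close> in
    \<open>f2 ^ a * u = f1 * w\<close>.\<close>
  define z where "z = v \<otimes> \<iota> u \<oplus> \<ominus> (u1 \<otimes> \<iota> w)"
  have z: "z \<in> nilradical" unfolding z_def using v f1 N.I_r_closed by simp
  note zc = nilradical_carrier[OF z]
  have eq: "y2 [^] a \<otimes> \<iota> u = y1 \<otimes> \<iota> w \<oplus> z"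
  proof -
    have "y2 [^] a \<otimes> \<iota> u = \<iota> (f2 ^ a * u) \<oplus> v \<otimes> \<iota> u"
      using v vc by (simp add: l_distr iota_mult)
    also have "\<iota> (f2 ^ a * u) = \<iota> f1 \<otimes> \<iota> w" by (simp add: w iota_mult)
    also have "\<dots> = y1 \<otimes> \<iota> w \<oplus> \<ominus> (u1 \<otimes> \<iota> w)"
      using f1 uc by (simp add: l_distr a_assoc r_neg)
    finally show ?thesis unfolding z_def using yc uc vc by (simp add: a_ac)
  qed
  obtain q :: nat where q: "z [^] q = \<zero>" using z unfolding nilradical_def by blast
  have "y1 \<otimes> \<iota> w \<in> carrier R" using yc by simp
  from add_pow_decomp[OF this zc, of 1 q] obtain x y where xy: "x \<in> carrier R" "y \<in> carrier R"
    "(y1 \<otimes> \<iota> w \<oplus> z) [^] (1 + q) = (y1 \<otimes> \<iota> w) [^] (1::nat) \<otimes> x \<oplus> z [^] q \<otimes> y"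
    by blast
  \<comment> \<open>In this power of \<open>y1 \<otimes> \<iota> w \<oplus> z\<close> each term
    contains \<open>y1\<close> or \<open>z ^ q = 0\<close>, so the power is a multiple of
    \<open>y1\<close>.\<close>
  define k where "k = 1 + q"
  have "(y2 [^] a \<otimes> \<iota> u) [^] k = (\<iota> w \<otimes> x) \<otimes> y1"
    unfolding eq k_def xy(3) q using xy(1,2) yc by (simp add: m_ac)
  then have "(y2 [^] a) [^] k \<otimes> \<iota> u [^] k = (\<iota> w \<otimes> x) \<otimes> y1"
    using yc by (simp only: nat_pow_distrib nat_pow_closed iota_closed)
  then have "(y2 [^] a) [^] k \<otimes> \<iota> u [^] k \<in> PIdl y1"
    using xy(1) unfolding cgenideal_def by blast
  then have ypow: "y2 [^] (a * k) \<otimes> \<iota> u [^] k \<in> PIdl y1" using yc by (simp add: nat_pow_pow)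
  have "r \<in> PIdl y1" if "r \<in> carrier R" "y2 [^] (n::nat) \<otimes> r \<in> PIdl y1" for n r
    using that
  proof (induction n arbitrary: r)
    case (Suc n)
    then have "y2 [^] n \<otimes> (y2 \<otimes> r) \<in> PIdl y1" using yc by (simp add: m_assoc)
    then have "y2 \<otimes> r \<in> PIdl y1" using Suc.IH[of "y2 \<otimes> r"] yc Suc.prems(1) by blast
    then show ?case by (rule reg2[OF Suc.prems(1)])
  qed simp
  then have "\<iota> u [^] k \<in> PIdl y1" using ypow by blast
  then have "\<iota> u [^] k \<in> P" using cgenideal_minimal[OF P.is_ideal yP(1)] by blast
  then show False using primeideal_pow[OF assms(1)] uP by blast
qed

text \<open>An element of \<open>P\<close> outside the nilradical has a nonzero polynomial part, and
  this part is a nonzerodivisor lying in \<open>P\<close>.\<close>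

lemma depth_maximal:
  assumes "maximalideal P R"
  shows "depth R P = 1"
proof -
  have P: "primeideal P R" using assms by (rule maximalideal_prime)
  interpret P: primeideal P R by fact
  obtain a where a: "a \<in> P" "a \<notin> nilradical" using nilradical_psubset_maximal[OF assms] by blast
  obtain f u where f: "u \<in> nilradical" "a = \<iota> f \<oplus> u" using decompose[OF P.Icarr[OF a(1)]] .
  have "f \<noteq> 0" using a f nilradical_carrier by auto
  have fP: "\<iota> f \<in> P" using a f decompose_mem_prime[OF P] by simp
  let ?S = "{ys. regular_sequence R ys \<and> set ys \<subseteq> P}"
  have "[\<iota> f] \<in> ?S" using regular_singleton[OF P fP \<open>f \<noteq> 0\<close>] fP by simp
  moreover have "length ys \<le> 1" if "ys \<in> ?S" for ys using that regular_sequence_length_le[OF P] by blast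
  ultimately show ?thesis unfolding depth_def
    by (intro antisym SUP_least SUP_upper2[of "[\<iota> f]"]) (auto simp: one_enat_def)
qed

lemma cohen_macaulay: "cohen_macaulay R"
proof -
  have "set (\<one> # bs) \<subseteq> carrier R" using bs_nil nilradical_carrier by auto
  then have "noetherian_ring R" using carrier_span by (rule noetherian)
  then show ?thesis
    unfolding cohen_macaulay_def using is_cring depth_maximal height_maximal by auto
qed

end

section \<open>The tangent cone\<close>

text \<open>These are the exponents of the monomials in the \<open>n\<close>-th power of the ideal
  generated by the \<open>t ^ h\<close>. The inequality on the length makes the chain
  decreasing.\<close>

definition level :: "nat set \<Rightarrow> nat \<Rightarrow> nat set" where
  "level B n = {s. \<exists>xs. set xs \<subseteq> B \<and> n \<le> length xs \<and> sum_list xs = s}"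

lemma level_0: "level B 0 = submonoid_gen B"
  unfolding level_def set_eq_iff submonoid_gen_iff_sum_list by simp

lemma level_antimono: "m \<le> n \<Longrightarrow> level B n \<subseteq> level B m"
  by (force simp: level_def)

lemma level_add: "s \<in> level B m \<Longrightarrow> t \<in> level B n \<Longrightarrow> s + t \<in> level B (m + n)"
proof -
  assume "s \<in> level B m" "t \<in> level B n"
  then obtain xs ys where "set xs \<subseteq> B" "m \<le> length xs" "sum_list xs = s"
    "set ys \<subseteq> B" "n \<le> length ys" "sum_list ys = t" by (auto simp: level_def)
  then show ?thesis unfolding level_def by (intro CollectI exI[of _ "xs @ ys"]) auto
qed

lemma level_mult: "h \<in> B \<Longrightarrow> k * h \<in> level B k"
  unfolding level_def by (intro CollectI exI[of _ "replicate k h"]) (auto simp: sum_list_replicate)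

lemma level_1: "h \<in> B \<Longrightarrow> h \<in> level B 1"
  using level_mult[of h B 1] by simp

lemma level_SucE:
  assumes "s \<in> level B (Suc n)"
  obtains h t where "h \<in> B" "t \<in> level B n" "s = t + h"
proof -
  obtain xs where xs: "set xs \<subseteq> B" "Suc n \<le> length xs" "sum_list xs = s"
    using assms by (auto simp: level_def)
  then obtain h ys where ys: "xs = h # ys" by (cases xs) auto
  show thesis using xs by (intro that[of h "sum_list ys"]) (auto simp: ys level_def)
qed

context exchange_semigroup
begin

lemma level_ge: "s \<in> level B n \<Longrightarrow> n * e \<le> s"
proof -
  assume "s \<in> level B n"
  then obtain xs where xs: "set xs \<subseteq> B" "n \<le> length xs" "sum_list xs = s" by (auto simp: level_def)
  have "n * e \<le> length xs * e" using xs by simp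
  also have "\<dots> \<le> s" using length_mult_le_sum_list[of xs e] xs e_le by auto
  finally show ?thesis .
qed

text \<open>The class of \<open>t ^ e\<close> is a nonzerodivisor of the tangent cone.\<close>

lemma level_cancel:
  assumes "s \<in> submonoid_gen B" "s + e \<in> level B (Suc n)"
  shows "s \<in> level B n"
proof -
  obtain xs where xs: "set xs \<subseteq> B" "sum_list xs = s"
    using assms(1) by (auto simp: submonoid_gen_iff_sum_list)
  obtain ys where ys: "set ys \<subseteq> B" "Suc n \<le> length ys" "sum_list ys = s + e"
    using assms(2) by (auto simp: level_def)
  show ?thesis
  proof (cases "n \<le> length xs")
    case True
    then show ?thesis using xs by (auto simp: level_def)
  next
    case False
    \<comment> \<open>Prepending \<open>e\<close> to the short factorization of \<open>s\<close>
      gives one of \<open>s + e\<close> that is shorter than \<open>ys\<close>.\<close>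
    then obtain zs where "set zs \<subseteq> B" "length ys = Suc (length zs)" "sum_list ys = e + sum_list zs"
      using exchange[of "e # xs" ys] xs ys e_in by auto
    then show ?thesis using ys by (auto simp: level_def)
  qed
qed

lemma level_cancel_mult:
  assumes "s \<in> submonoid_gen B" "s + k * e \<in> level B (n + k)"
  shows "s \<in> level B n"
  using assms
proof (induction k)
  case (Suc k)
  have "s + k * e \<in> submonoid_gen B"
    using submonoid_gen_add[OF Suc.prems(1) submonoid_gen_mult[OF submonoid_gen_incl[OF e_in]]] .
  moreover have "(s + k * e) + e \<in> level B (Suc (n + k))" using Suc.prems(2) by (simp add: ac_simps)
  ultimately have "s + k * e \<in> level B (n + k)" by (rule level_cancel)
  then show ?case using Suc by blast
qed simp

text \<open>This \<open>n\<close> is the order of \<open>s\<close>. It exists because every term is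
  at least \<open>e \<ge> 1\<close>, so no factorization of \<open>s\<close> has more than
  \<open>s\<close> terms.\<close>

lemma level_exact:
  assumes "s \<in> submonoid_gen B"
  obtains n where "s \<in> level B n" "s \<notin> level B (Suc n)"
proof -
  have bound: "n \<le> s" if "s \<in> level B n" for n
  proof -
    have "n \<le> n * e" using e_pos by simp
    then show ?thesis using level_ge[OF that] by (rule le_trans)
  qed
  define n where "n = (GREATEST n. s \<in> level B n)"
  have "s \<in> level B n" unfolding n_def
    by (rule GreatestI_nat[of _ 0]) (use assms level_0 bound in auto)
  moreover have "s \<notin> level B (Suc n)"
    using Greatest_le_nat[of "\<lambda>n. s \<in> level B n" "Suc n" s] bound unfolding n_def by auto
  ultimately show thesis by (rule that)
qed

lemma apery_decompose:
  "s \<in> submonoid_gen B \<Longrightarrow> \<exists>w\<in>apery (submonoid_gen B) e. \<exists>k. s = w + k * e"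
proof (induction s rule: less_induct)
  case (less s)
  show ?case
  proof (cases "s \<in> apery (submonoid_gen B) e")
    case True
    then show ?thesis by (intro bexI[of _ s] exI[of _ 0]) auto
  next
    case False
    then obtain y where y: "y \<in> submonoid_gen B" "s = y + e" using less.prems by (auto simp: apery_def)
    then obtain w k where "w \<in> apery (submonoid_gen B) e" "y = w + k * e"
      using less.IH[of y] e_pos by auto
    then show ?thesis using y by (intro bexI[of _ w] exI[of _ "Suc k"]) auto
  qed
qed

text \<open>Two distinct Apery elements in one residue class modulo \<open>e\<close> would differ by
  a positive multiple of \<open>e\<close>, and \<open>e\<close> could be subtracted from the larger
  one inside the semigroup.\<close>

lemma apery_finite: "finite (apery (submonoid_gen B) e)"
proof (rule inj_on_finite)
  show "(\<lambda>w. w mod e) ` apery (submonoid_gen B) e \<subseteq> {..<e}" using e_pos by auto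
  have "w = w'" if ww: "w \<in> apery (submonoid_gen B) e" "w' \<in> apery (submonoid_gen B) e"
    "w mod e = w' mod e" "w \<le> w'" for w w'
  proof (rule ccontr)
    assume "w \<noteq> w'"
    obtain k where k: "w' = w + k * e"
      using ww(3,4) by (metis mod_eq_nat2E mult.commute)
    with \<open>w \<noteq> w'\<close> obtain l where l: "k = Suc l" by (cases k) auto
    have "w \<in> submonoid_gen B" using ww(1) by (simp add: apery_def)
    then have "w + l * e \<in> submonoid_gen B"
      by (rule submonoid_gen_add) (intro submonoid_gen_mult submonoid_gen_incl e_in)
    moreover have "w' = (w + l * e) + e" by (simp add: k l)
    ultimately show False using ww(2) unfolding apery_def by blast
  qed
  then show "inj_on (\<lambda>w. w mod e) (apery (submonoid_gen B) e)"
    unfolding inj_on_def by (metis nat_le_linear)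
qed simp

text \<open>Rewriting \<open>e\<close> copies of \<open>w\<close> as \<open>w\<close> copies of \<open>e\<close> raises the order.\<close>

lemma apery_mult_level:
  assumes "w \<in> apery (submonoid_gen B) e" "w \<noteq> 0" "w \<in> level B l"
  shows "w * e \<in> level B (Suc (l * e))"
proof -
  have "l * e \<noteq> w"
  proof
    assume w: "l * e = w"
    then obtain k where "l = Suc k" using assms(2) by (cases l) auto
    then have "w = k * e + e" using w by simp
    moreover have "k * e \<in> submonoid_gen B" by (intro submonoid_gen_mult submonoid_gen_incl e_in)
    ultimately show False using assms(1) by (auto simp: apery_def)
  qed
  \<comment> \<open>Strictness is the point: \<open>w\<close> copies of \<open>e\<close> are more
    than the \<open>l * e\<close> terms expected of \<open>e\<close> copies of
    \<open>w\<close>.\<close>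
  then have "Suc (l * e) \<le> w" using level_ge[OF assms(3)] by simp
  then show ?thesis using level_antimono[of "Suc (l * e)" w B] level_mult[OF e_in, of w] by blast
qed

end

section \<open>Powers of the ideal of the generators\<close>

text \<open>The ideal power in monomial form, see \<open>ideal_pow_eq\<close>; for
  \<open>n = 0\<close> it is the semigroup ring itself. Membership is thus decided one exponent at a
  time.\<close>

definition filt :: "nat set \<Rightarrow> nat \<Rightarrow> 'k::field poly set" where
  "filt B n = {p. \<forall>s. Polynomial.coeff p s \<noteq> 0 \<longrightarrow> s \<in> level B n}"

lemma filt_zero: "0 \<in> filt B n"
  by (simp add: filt_def)

lemma filt_add: "p \<in> filt B n \<Longrightarrow> q \<in> filt B n \<Longrightarrow> p + q \<in> filt B n"
proof -
  assume pq: "p \<in> filt B n" "q \<in> filt B n"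
  have "s \<in> level B n" if "Polynomial.coeff (p + q) s \<noteq> 0" for s
    using pq that by (cases "Polynomial.coeff p s = 0") (auto simp: filt_def)
  then show ?thesis by (simp add: filt_def)
qed

lemma filt_uminus: "p \<in> filt B n \<Longrightarrow> - p \<in> filt B n"
  by (simp add: filt_def)

lemma filt_diff: "p \<in> filt B n \<Longrightarrow> q \<in> filt B n \<Longrightarrow> p - q \<in> filt B n"
  using filt_add[of p B n "- q"] filt_uminus[of q B n] by simp

lemma filt_sum: "(\<And>i. i \<in> S \<Longrightarrow> p i \<in> filt B n) \<Longrightarrow> sum p S \<in> filt B n"
  by (induction S rule: infinite_finite_induct) (auto intro: filt_zero filt_add)

lemma filt_mult:
  assumes "p \<in> filt B m" "q \<in> filt B n"
  shows "p * q \<in> filt B (m + n)"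
  unfolding filt_def
proof (intro CollectI allI impI)
  fix s assume "Polynomial.coeff (p * q) s \<noteq> 0"
  then obtain i where "i \<le> s" "Polynomial.coeff p i * Polynomial.coeff q (s - i) \<noteq> 0"
    unfolding Polynomial.coeff_mult by (meson atMost_iff sum.not_neutral_contains_not_neutral)
  then have "i \<in> level B m" "s - i \<in> level B n" "s = i + (s - i)" using assms by (auto simp: filt_def)
  then show "s \<in> level B (m + n)" using level_add by metis
qed

lemma filt_monom: "s \<in> level B n \<Longrightarrow> Polynomial.monom c s \<in> filt B n"
  by (auto simp: filt_def split: if_splits)

lemma filt_antimono: "m \<le> n \<Longrightarrow> filt B n \<subseteq> filt B m"
  using level_antimono[of m n B] by (auto simp: filt_def)

lemma filt_1: "1 \<in> filt B 0"
  using filt_monom[of 0 B 0 1] by (simp add: level_0 submonoid_gen.zero)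

lemma sum_closed_induct:
  assumes "Q 0" "\<And>x y. Q x \<Longrightarrow> Q y \<Longrightarrow> Q (x + y)" "\<And>i. i \<in> S \<Longrightarrow> Q (f i)"
  shows "Q (sum f S)"
  using assms(3) by (induction S rule: infinite_finite_induct) (auto intro: assms(1,2))

lemma filt_induct [consumes 1, case_names zero add monom]:
  assumes "p \<in> filt B n" "Q 0" "\<And>p q. Q p \<Longrightarrow> Q q \<Longrightarrow> Q (p + q)"
    and "\<And>c s. s \<in> level B n \<Longrightarrow> Q (Polynomial.monom c s)"
  shows "Q p"
proof -
  have "Q (\<Sum>i\<le>Polynomial.degree p. Polynomial.monom (Polynomial.coeff p i) i)"
  proof (rule sum_closed_induct[of Q])
    fix i
    show "Q (Polynomial.monom (Polynomial.coeff p i) i)"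
      using assms by (cases "Polynomial.coeff p i = 0") (auto simp: filt_def)
  qed (fact assms)+
  then show ?thesis by (simp only: poly_as_sum_of_monoms)
qed

lemma type_algebra_simps:
  "carrier (ring_of_type_algebra :: 'a::comm_ring_1 ring) = UNIV"
  "x \<otimes>\<^bsub>ring_of_type_algebra\<^esub> y = x * y"
  "x \<oplus>\<^bsub>ring_of_type_algebra\<^esub> y = x + y"
  "\<one>\<^bsub>ring_of_type_algebra\<^esub> = 1"
  "\<zero>\<^bsub>ring_of_type_algebra\<^esub> = 0"
  by (simp_all add: ring_of_type_algebra_def)

lemma type_algebra_a_inv:
  fixes x :: "'a::comm_ring_1"
  shows "\<ominus>\<^bsub>ring_of_type_algebra\<^esub> x = - x"
proof -
  interpret cring "ring_of_type_algebra :: 'a ring" by (rule cring_from_type_algebra)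
  show ?thesis by (rule minus_equality) (simp_all add: type_algebra_simps)
qed

locale tangent_semigroup = exchange_semigroup +
  fixes K :: "'k::field itself"
  assumes min_gens: "min_gens (submonoid_gen B) = B"
begin

abbreviation SR :: "'k poly ring" where "SR \<equiv> semigroup_ring K (submonoid_gen B)"

lemma SR_simps [simp]:
  "x \<otimes>\<^bsub>SR\<^esub> y = x * y" "x \<oplus>\<^bsub>SR\<^esub> y = x + y" "\<one>\<^bsub>SR\<^esub> = 1" "\<zero>\<^bsub>SR\<^esub> = 0"
  by (simp_all add: semigroup_ring_def type_algebra_simps)

lemma SR_carrier: "carrier SR = filt B 0"
proof -
  let ?A = "ring_of_type_algebra :: 'k poly ring"
  let ?G = "range (\<lambda>c. [:c:]) \<union> Polynomial.monom 1 ` B :: 'k poly set"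
  interpret A: cring ?A by (rule cring_from_type_algebra)
  have "generate_ring ?A ?G = filt B 0"
  proof (intro equalityI subsetI)
    fix p assume "p \<in> generate_ring ?A ?G"
    then show "p \<in> filt B 0"
    proof (induction rule: generate_ring.induct)
      case (incl h)
      have "[:c:] \<in> filt B 0" for c :: 'k
        using filt_monom[of 0 B 0 c] by (simp add: level_0 submonoid_gen.zero monom_0)
      moreover have "Polynomial.monom 1 b \<in> filt B 0" if "b \<in> B" for b
        using that by (intro filt_monom) (simp add: level_0 submonoid_gen_incl)
      ultimately show ?case using incl by auto
    next
      case (eng_mult p q)
      then show ?case using filt_mult[of p B 0 q 0] by (simp add: type_algebra_simps)
    qed (auto simp: type_algebra_simps type_algebra_a_inv intro: filt_1 filt_add filt_uminus)
  next
    fix p :: "'k poly" assume "p \<in> filt B 0"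
    then show "p \<in> generate_ring ?A ?G"
    proof (induction rule: filt_induct)
      case zero
      show ?case using A.zero_in_generate[of ?G] by (simp add: type_algebra_simps)
    next
      case (add p q)
      then show ?case using generate_ring.eng_add[of p ?A ?G q] by (simp add: type_algebra_simps)
    next
      case (monom c s)
      then have "s \<in> submonoid_gen B" by (simp add: level_0)
      then show ?case
      proof (induction rule: submonoid_gen.induct)
        case zero
        show ?case by (intro generate_ring.incl) (simp add: monom_0)
      next
        case (add h s)
        have "Polynomial.monom 1 h \<in> generate_ring ?A ?G" using add by (intro generate_ring.incl) simp
        from generate_ring.eng_mult[OF this add.IH] show ?case by (simp add: type_algebra_simps mult_monom)
      qed
    qed
  qed
  then show ?thesis by (simp add: semigroup_ring_def min_gens)
qed

lemma SR_cring: "cring SR"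
proof (rule cringI)
  show "abelian_group SR"
  proof (rule abelian_groupI)
    show "\<exists>y\<in>carrier SR. y \<oplus>\<^bsub>SR\<^esub> x = \<zero>\<^bsub>SR\<^esub>" if "x \<in> carrier SR" for x
      using that by (intro bexI[of _ "- x"]) (auto simp: SR_carrier filt_uminus)
  qed (simp_all add: SR_carrier filt_add filt_zero ac_simps)
  show "comm_monoid SR"
  proof (rule comm_monoidI)
    show "x \<otimes>\<^bsub>SR\<^esub> y \<in> carrier SR" if "x \<in> carrier SR" "y \<in> carrier SR" for x y
      using that filt_mult[of x B 0 y 0] by (simp add: SR_carrier)
  qed (simp_all add: SR_carrier filt_1 ac_simps)
qed (simp add: algebra_simps)

sublocale SR: cring SR by (rule SR_cring)

lemma SR_a_inv: "x \<in> filt B 0 \<Longrightarrow> \<ominus>\<^bsub>SR\<^esub> x = - x"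
  by (rule SR.minus_equality) (simp_all add: SR_carrier filt_uminus)

lemma SR_minus: "x \<in> filt B 0 \<Longrightarrow> y \<in> filt B 0 \<Longrightarrow> x \<ominus>\<^bsub>SR\<^esub> y = x - y"
  by (simp add: a_minus_def SR_a_inv)

lemma filt_subset: "filt B n \<subseteq> filt B 0"
  by (rule filt_antimono) simp

lemma filt_ideal: "ideal (filt B n) SR"
proof (rule idealI[OF SR.ring_axioms])
  show "subgroup (filt B n) (add_monoid SR)"
  proof (rule SR.add.subgroupI)
    show "filt B n \<subseteq> carrier SR" unfolding SR_carrier by (rule filt_subset)
    show "filt B n \<noteq> {}" using filt_zero by blast
    show "\<ominus>\<^bsub>SR\<^esub> a \<in> filt B n" if "a \<in> filt B n" for a
      using that subsetD[OF filt_subset that] by (simp add: SR_a_inv filt_uminus)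
  qed (simp add: filt_add)
  show "x \<otimes>\<^bsub>SR\<^esub> a \<in> filt B n" "a \<otimes>\<^bsub>SR\<^esub> x \<in> filt B n" if "a \<in> filt B n" "x \<in> carrier SR" for a x
    using filt_mult[of a B n x 0] that by (simp_all add: SR_carrier mult.commute)
qed

lemma semigroup_ideal_eq: "semigroup_ideal K (submonoid_gen B) = filt B 1"
proof -
  let ?G = "Polynomial.monom 1 ` B :: 'k poly set"
  have sub: "?G \<subseteq> filt B 1" using level_1 by (auto intro!: filt_monom)
  then have car: "?G \<subseteq> carrier SR" using filt_subset[of 1] by (auto simp: SR_carrier)
  interpret I: ideal "Idl\<^bsub>SR\<^esub> ?G" SR by (rule SR.genideal_ideal[OF car])
  have "Idl\<^bsub>SR\<^esub> ?G \<subseteq> filt B 1" using filt_ideal sub by (rule SR.genideal_minimal)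
  moreover have "p \<in> Idl\<^bsub>SR\<^esub> ?G" if "p \<in> filt B 1" for p
    using that
  proof (induction rule: filt_induct)
    case zero
    show ?case using I.zero_closed by simp
  next
    case (add p q)
    then show ?case using I.a_closed by simp
  next
    case (monom c s)
    then obtain h t where ht: "h \<in> B" "t \<in> level B 0" "s = t + h" using level_SucE[of s B 0] by auto
    have "Polynomial.monom 1 h \<in> Idl\<^bsub>SR\<^esub> ?G" using SR.genideal_self[OF car] ht by blast
    moreover have "Polynomial.monom c t \<in> carrier SR" using ht by (simp add: SR_carrier filt_monom)
    ultimately have "Polynomial.monom c t \<otimes>\<^bsub>SR\<^esub> Polynomial.monom 1 h \<in> Idl\<^bsub>SR\<^esub> ?G" by (rule I.I_l_closed)
    then show ?case by (simp add: mult_monom ht)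
  qed
  ultimately show ?thesis unfolding semigroup_ideal_def min_gens by blast
qed

lemma ideal_pow_eq: "ideal_pow SR (filt B 1) n = filt B n"
proof (induction n)
  case 0
  show ?case by (simp add: SR_carrier)
next
  case (Suc n)
  have "ideal_prod SR (filt B n) (filt B 1) = filt B (Suc n)"
  proof (intro equalityI subsetI)
    fix p assume "p \<in> ideal_prod SR (filt B n) (filt B 1)"
    then show "p \<in> filt B (Suc n)"
    proof (induction rule: ideal_prod.induct)
      case (prod i j)
      then show ?case using filt_mult[of i B n j 1] by simp
    qed (simp add: filt_add)
  next
    fix p :: "'k poly" assume "p \<in> filt B (Suc n)"
    then show "p \<in> ideal_prod SR (filt B n) (filt B 1)"
    proof (induction rule: filt_induct)
      case zero
      show ?case using ideal_prod.prod[of 0 "filt B n" 0 "filt B 1" SR] by (simp add: filt_zero)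
    next
      case (add p q)
      then show ?case using ideal_prod.sum[of p SR "filt B n" "filt B 1" q] by simp
    next
      case (monom c s)
      then obtain h t where ht: "h \<in> B" "t \<in> level B n" "s = t + h" by (rule level_SucE)
      have "Polynomial.monom c t \<otimes>\<^bsub>SR\<^esub> Polynomial.monom 1 h \<in> ideal_prod SR (filt B n) (filt B 1)"
        using ht level_1 by (intro ideal_prod.prod filt_monom) auto
      then show ?case by (simp add: mult_monom ht)
    qed
  qed
  with Suc show ?case by simp
qed

end

section \<open>The tangent cone as an image of the Rees algebra\<close>

text \<open>Compatibility of \<open>h\<close> is required only on \<open>A\<close>, because
  \<open>cls_mult\<close> is available only on \<open>rees\<close>.\<close>

lemma cring_image:
  fixes h :: "'b::comm_ring_1 \<Rightarrow> 'a" and G (structure)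
  assumes A: "0 \<in> A" "1 \<in> A" "\<And>x y. x \<in> A \<Longrightarrow> y \<in> A \<Longrightarrow> x + y \<in> A"
      "\<And>x y. x \<in> A \<Longrightarrow> y \<in> A \<Longrightarrow> x * y \<in> A" "\<And>x. x \<in> A \<Longrightarrow> - x \<in> A"
    and carrier: "carrier G = h ` A"
    and h: "h 0 = \<zero>" "h 1 = \<one>" "\<And>x y. x \<in> A \<Longrightarrow> y \<in> A \<Longrightarrow> h x \<oplus> h y = h (x + y)"
      "\<And>x y. x \<in> A \<Longrightarrow> y \<in> A \<Longrightarrow> h x \<otimes> h y = h (x * y)"
  shows "cring G"
proof (rule cringI)
  show "abelian_group G"
  proof (rule abelian_groupI)
    show "\<exists>y\<in>carrier G. y \<oplus> x = \<zero>" if "x \<in> carrier G" for x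
    proof -
      obtain a where "a \<in> A" "x = h a" using \<open>x \<in> carrier G\<close> carrier by auto
      then show ?thesis using A(5) h(1,3) carrier by (intro bexI[of _ "h (- a)"]) auto
    qed
  qed (use A in \<open>auto simp: carrier h(3) ac_simps simp flip: h(1)\<close>)
  show "comm_monoid G"
    by (rule comm_monoidI) (use A in \<open>auto simp: carrier h(4) ac_simps simp flip: h(2)\<close>)
qed (use A in \<open>auto simp: carrier h(3,4) distrib_right\<close>)

lemma poly_with_coeffs:
  assumes "finite {n. a n \<noteq> (0::'a::comm_monoid_add)}"
  shows "\<exists>P. \<forall>n. Polynomial.coeff P n = a n"
proof -
  obtain N where N: "\<forall>n. a n \<noteq> 0 \<longrightarrow> n < N"
    using finite_nat_set_iff_bounded[THEN iffD1, OF assms] by auto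
  have "Polynomial.coeff (Poly (map a [0..<N])) n = a n" for n
    using N by (cases "n < N") (auto simp: nth_default_def)
  then show ?thesis by blast
qed

context tangent_semigroup
begin

abbreviation G where "G \<equiv> tangent_cone K (submonoid_gen B)"

lemma G_def: "G = assoc_graded SR (filt B 1)"
  by (simp add: tangent_cone_def semigroup_ideal_eq)

lemma filt_coset_zero: "p \<in> filt B n \<Longrightarrow> filt B n +>\<^bsub>SR\<^esub> p = filt B n"
  by (rule SR.a_rcos_zero[OF filt_ideal])

lemma filt_coset_eq:
  assumes "p \<in> filt B 0" "q \<in> filt B 0"
  shows "filt B n +>\<^bsub>SR\<^esub> p = filt B n +>\<^bsub>SR\<^esub> q \<longleftrightarrow> p - q \<in> filt B n"
  using SR.quotient_eq_iff_same_a_r_cos[OF filt_ideal, of p q n] assms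
  by (simp add: SR_carrier SR_minus)

text \<open>The factors are cosets of two different ideals. \<open>rcoset_mult\<close> unites the
  cosets of all products of representatives, so these cosets have to coincide, and there has to be
  at least one.\<close>

lemma filt_coset_mult:
  assumes "p \<in> filt B i" "q \<in> filt B j"
  shows "rcoset_mult SR (filt B (Suc (i + j))) (filt B (Suc i) +>\<^bsub>SR\<^esub> p) (filt B (Suc j) +>\<^bsub>SR\<^esub> q)
    = filt B (Suc (i + j)) +>\<^bsub>SR\<^esub> (p * q)"
proof -
  have mem: "x \<in> filt B n +>\<^bsub>SR\<^esub> y \<longleftrightarrow> (\<exists>z\<in>filt B n. x = z + y)" for x y n
    by (auto simp: a_r_coset_def')
  have "filt B (Suc (i + j)) +>\<^bsub>SR\<^esub> (a \<otimes>\<^bsub>SR\<^esub> b) = filt B (Suc (i + j)) +>\<^bsub>SR\<^esub> (p * q)"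
    if ab: "a \<in> filt B (Suc i) +>\<^bsub>SR\<^esub> p" "b \<in> filt B (Suc j) +>\<^bsub>SR\<^esub> q" for a b
  proof -
    obtain u v where uv: "u \<in> filt B (Suc i)" "a = u + p" "v \<in> filt B (Suc j)" "b = v + q"
      using ab mem by metis
    have b: "b \<in> filt B j" unfolding uv(4) using uv(3) assms(2) filt_antimono[of j "Suc j" B] by (intro filt_add) auto
    have a: "a \<in> filt B i" unfolding uv(2) using uv(1) assms(1) filt_antimono[of i "Suc i" B] by (intro filt_add) auto
    \<comment> \<open>Each summand has one factor a step deeper in the filtration, which accounts
      for the \<open>Suc\<close>.\<close>
    have "a * b - p * q = u * b + p * v" by (simp add: uv algebra_simps)
    moreover have "u * b \<in> filt B (Suc (i + j))" using filt_mult[OF uv(1) b] by simp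
    moreover have "p * v \<in> filt B (Suc (i + j))" using filt_mult[OF assms(1) uv(3)] by simp
    ultimately have "a * b - p * q \<in> filt B (Suc (i + j))" using filt_add by metis
    then show ?thesis
      using filt_coset_eq[of "a * b" "p * q"] filt_mult[OF a b] filt_mult[OF assms] filt_subset by auto
  qed
  moreover have "p \<in> filt B (Suc i) +>\<^bsub>SR\<^esub> p" "q \<in> filt B (Suc j) +>\<^bsub>SR\<^esub> q"
    using filt_zero by (auto simp: mem)
  ultimately show ?thesis unfolding rcoset_mult_def by blast
qed

lemma finsum_coset:
  assumes "finite S" "\<And>i. i \<in> S \<Longrightarrow> p i \<in> filt B 0"
  shows "finsum (SR Quot filt B n) (\<lambda>i. filt B n +>\<^bsub>SR\<^esub> p i) S = filt B n +>\<^bsub>SR\<^esub> sum p S"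
proof -
  interpret I: ideal "filt B n" SR by (rule filt_ideal)
  interpret Q: ring "SR Quot filt B n" by (rule I.quotient_is_ring)
  have car: "filt B n +>\<^bsub>SR\<^esub> q \<in> carrier (SR Quot filt B n)" if "q \<in> filt B 0" for q
    using that ring_hom_closed[OF I.rcos_ring_hom, of q] by (simp add: SR_carrier)
  have add: "(filt B n +>\<^bsub>SR\<^esub> q) \<oplus>\<^bsub>SR Quot filt B n\<^esub> (filt B n +>\<^bsub>SR\<^esub> r) = filt B n +>\<^bsub>SR\<^esub> (q + r)"
    if "q \<in> filt B 0" "r \<in> filt B 0" for q r
    using that ring_hom_add[OF I.rcos_ring_hom, of q r] by (simp add: SR_carrier)
  have zero: "\<zero>\<^bsub>SR Quot filt B n\<^esub> = filt B n +>\<^bsub>SR\<^esub> 0"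
    by (simp add: FactRing_def filt_coset_zero filt_zero)
  show ?thesis using assms
  proof (induction S)
    case empty
    show ?case by (simp add: zero)
  next
    case (insert i S)
    then show ?case
      by (subst Q.finsum_insert) (auto simp: Pi_def car add filt_sum)
  qed
qed

text \<open>The outer variable marks the degree, so the convolution in \<open>assoc_graded\<close>
  becomes ordinary multiplication of polynomials.\<close>

definition rees :: "'k poly poly set" where
  "rees = {P. \<forall>n. Polynomial.coeff P n \<in> filt B n}"

definition cls :: "'k poly poly \<Rightarrow> nat \<Rightarrow> 'k poly set" where
  "cls P = (\<lambda>n. filt B (Suc n) +>\<^bsub>SR\<^esub> Polynomial.coeff P n)"

lemma rees_coeff: "P \<in> rees \<Longrightarrow> Polynomial.coeff P n \<in> filt B n"
  by (simp add: rees_def)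

lemma rees_coeff': "P \<in> rees \<Longrightarrow> Polynomial.coeff P n \<in> filt B 0"
  using rees_coeff filt_subset by blast

lemma rees_zero: "0 \<in> rees" and rees_one: "1 \<in> rees"
  and rees_add: "P \<in> rees \<Longrightarrow> Q \<in> rees \<Longrightarrow> P + Q \<in> rees"
  and rees_uminus: "P \<in> rees \<Longrightarrow> - P \<in> rees"
  by (auto simp: rees_def filt_zero filt_1 filt_add filt_uminus)

lemma rees_mult: "P \<in> rees \<Longrightarrow> Q \<in> rees \<Longrightarrow> P * Q \<in> rees"
proof -
  assume PQ: "P \<in> rees" "Q \<in> rees"
  have "Polynomial.coeff (P * Q) n \<in> filt B n" for n
    unfolding Polynomial.coeff_mult
  proof (rule filt_sum)
    fix i assume "i \<in> {..n}"
    then show "Polynomial.coeff P i * Polynomial.coeff Q (n - i) \<in> filt B n"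
      using filt_mult[OF rees_coeff[OF PQ(1), of i] rees_coeff[OF PQ(2), of "n - i"]] by simp
  qed
  then show ?thesis by (simp add: rees_def)
qed

lemma rees_monom: "p \<in> filt B n \<Longrightarrow> Polynomial.monom p n \<in> rees"
  by (simp add: rees_def filt_zero)

lemma cls_eq_iff:
  assumes "P \<in> rees" "Q \<in> rees"
  shows "cls P = cls Q \<longleftrightarrow> (\<forall>n. Polynomial.coeff P n - Polynomial.coeff Q n \<in> filt B (Suc n))"
  unfolding cls_def fun_eq_iff using filt_coset_eq assms rees_coeff' by auto

lemma cls_eq_zero_iff:
  assumes "P \<in> rees"
  shows "cls P = cls 0 \<longleftrightarrow> (\<forall>n. Polynomial.coeff P n \<in> filt B (Suc n))"
  using cls_eq_iff[OF assms rees_zero] by simp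

lemma cls_0: "\<zero>\<^bsub>G\<^esub> = cls 0"
  unfolding G_def assoc_graded_def ideal_pow_eq by (simp add: cls_def filt_coset_zero filt_zero)

lemma cls_1: "\<one>\<^bsub>G\<^esub> = cls 1"
  unfolding G_def assoc_graded_def ideal_pow_eq
  by (auto simp: cls_def fun_eq_iff filt_coset_zero filt_zero)

lemma cls_add: "P \<in> rees \<Longrightarrow> Q \<in> rees \<Longrightarrow> cls P \<oplus>\<^bsub>G\<^esub> cls Q = cls (P + Q)"
  using ideal.a_rcos_sum[OF filt_ideal] rees_coeff'
  by (auto simp: G_def assoc_graded_def cls_def fun_eq_iff SR_carrier)

lemma cls_mult:
  assumes "P \<in> rees" "Q \<in> rees"
  shows "cls P \<otimes>\<^bsub>G\<^esub> cls Q = cls (P * Q)"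
proof
  fix n
  let ?I = "filt B (Suc n)"
  let ?p = "\<lambda>i. Polynomial.coeff P i * Polynomial.coeff Q (n - i)"
  have closed: "?p i \<in> filt B 0" for i
    using filt_mult[OF rees_coeff'[OF assms(1), of i] rees_coeff'[OF assms(2), of "n - i"]] by simp
  interpret I: ideal ?I SR by (rule filt_ideal)
  interpret Q: ring "SR Quot ?I" by (rule I.quotient_is_ring)
  have "(cls P \<otimes>\<^bsub>G\<^esub> cls Q) n = finsum (SR Quot ?I) (\<lambda>i. rcoset_mult SR ?I (cls P i) (cls Q (n - i))) {..n}"
    unfolding G_def assoc_graded_def ideal_pow_eq by simp
  also have "\<dots> = finsum (SR Quot ?I) (\<lambda>i. ?I +>\<^bsub>SR\<^esub> ?p i) {..n}"
  proof (rule Q.finsum_cong')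
    show "(\<lambda>i. ?I +>\<^bsub>SR\<^esub> ?p i) \<in> {..n} \<rightarrow> carrier (SR Quot ?I)"
      using ring_hom_closed[OF I.rcos_ring_hom] closed by (auto simp: SR_carrier)
    show "rcoset_mult SR ?I (cls P i) (cls Q (n - i)) = ?I +>\<^bsub>SR\<^esub> ?p i" if "i \<in> {..n}" for i
      using filt_coset_mult[OF rees_coeff[OF assms(1), of i] rees_coeff[OF assms(2), of "n - i"]] that
      by (simp add: cls_def)
  qed simp
  also have "\<dots> = ?I +>\<^bsub>SR\<^esub> sum ?p {..n}" by (rule finsum_coset) (auto simp: closed)
  finally show "(cls P \<otimes>\<^bsub>G\<^esub> cls Q) n = cls (P * Q) n" by (simp add: cls_def Polynomial.coeff_mult)
qed

lemma carrier_G: "carrier G = cls ` rees"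
proof (intro equalityI subsetI)
  fix f assume "f \<in> carrier G"
  then have f: "\<forall>n. \<exists>a\<in>filt B n. f n = filt B (Suc n) +>\<^bsub>SR\<^esub> a" "finite {n. f n \<noteq> filt B (Suc n)}"
    unfolding G_def assoc_graded_def ideal_pow_eq by simp_all
  \<comment> \<open>Zero cosets get the representative \<open>0\<close>; otherwise the chosen
    coefficients might fail to have finite support.\<close>
  have "\<forall>n. \<exists>a. a \<in> filt B n \<and> f n = filt B (Suc n) +>\<^bsub>SR\<^esub> a \<and> (f n = filt B (Suc n) \<longrightarrow> a = 0)"
    using f(1) filt_coset_zero[OF filt_zero] filt_zero by metis
  then obtain a where a: "\<And>n. a n \<in> filt B n" "\<And>n. f n = filt B (Suc n) +>\<^bsub>SR\<^esub> a n"
    "\<And>n. f n = filt B (Suc n) \<Longrightarrow> a n = 0" by metis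
  have "finite {n. a n \<noteq> 0}" by (rule finite_subset[OF _ f(2)]) (use a(3) in auto)
  then obtain P where P: "\<forall>n. Polynomial.coeff P n = a n" using poly_with_coeffs by blast
  have "P \<in> rees" "f = cls P" using a P by (auto simp: rees_def cls_def)
  then show "f \<in> cls ` rees" by blast
next
  fix f assume "f \<in> cls ` rees"
  then obtain P where P: "P \<in> rees" "f = cls P" by blast
  have "{n. f n \<noteq> filt B (Suc n)} \<subseteq> {..Polynomial.degree P}"
    using filt_coset_zero[OF filt_zero] Polynomial.coeff_eq_0[of P] unfolding P(2) cls_def
    by (metis (mono_tags, lifting) atMost_iff linorder_not_le mem_Collect_eq subsetI)
  then have "finite {n. f n \<noteq> filt B (Suc n)}" using finite_subset by blast
  moreover have "\<exists>a\<in>filt B n. f n = filt B (Suc n) +>\<^bsub>SR\<^esub> a" for n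
    using rees_coeff[OF P(1)] by (auto simp: P(2) cls_def)
  ultimately show "f \<in> carrier G" unfolding G_def assoc_graded_def ideal_pow_eq by simp
qed

lemma cring_G: "cring G"
  by (rule cring_image[where A = rees and h = cls])
    (simp_all add: rees_zero rees_one rees_add rees_mult rees_uminus carrier_G cls_0 cls_1 cls_add cls_mult)

sublocale G: cring G by (rule cring_G)

lemma cls_closed: "P \<in> rees \<Longrightarrow> cls P \<in> carrier G"
  by (simp add: carrier_G)

lemma cls_pow: "P \<in> rees \<Longrightarrow> P ^ n \<in> rees \<and> cls P [^]\<^bsub>G\<^esub> n = cls (P ^ n)"
proof (induction n)
  case (Suc n)
  then show ?case by (simp add: cls_mult rees_mult mult.commute)
qed (simp add: rees_one cls_1)

section \<open>The k[x]-structure of the tangent cone\<close>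

text \<open>The substitution sending the variable of \<open>f\<close> to \<open>t ^ e\<close> times
  the outer variable; its class is \<open>f\<close> evaluated at \<open>x\<close>.\<close>

definition param :: "'k poly \<Rightarrow> 'k poly poly" where
  "param f = Poly (map (\<lambda>n. Polynomial.monom (Polynomial.coeff f n) (n * e)) [0..<Suc (Polynomial.degree f)])"

lemma coeff_param: "Polynomial.coeff (param f) n = Polynomial.monom (Polynomial.coeff f n) (n * e)"
  by (cases "n \<le> Polynomial.degree f")
    (auto simp: param_def nth_default_def Polynomial.coeff_eq_0 simp del: upt_Suc)

lemma param_rees: "param f \<in> rees"
  by (simp add: rees_def coeff_param filt_monom level_mult e_in)

lemma param_add: "param (f + g) = param f + param g"
  by (rule poly_eqI) (simp add: coeff_param add_monom)

lemma param_1: "param 1 = 1"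
  by (rule poly_eqI) (simp add: coeff_param)

lemma param_mult: "param (f * g) = param f * param g"
proof (rule poly_eqI)
  fix n
  have "Polynomial.coeff (param f * param g) n
    = (\<Sum>i\<le>n. Polynomial.monom (Polynomial.coeff f i * Polynomial.coeff g (n - i)) (n * e))"
    unfolding Polynomial.coeff_mult coeff_param mult_monom
    by (intro sum.cong) (auto simp: algebra_simps simp flip: add_mult_distrib)
  then show "Polynomial.coeff (param (f * g)) n = Polynomial.coeff (param f * param g) n"
    by (simp add: coeff_param Polynomial.coeff_mult monom_sum)
qed

lemma param_monom: "param (Polynomial.monom c k) = Polynomial.monom (Polynomial.monom c (k * e)) k"
  by (rule poly_eqI) (simp add: coeff_param)

text \<open>Comparison of lowest terms: \<open>n\<close> is the first degree in which
  \<open>P\<close> has a nonzero class, \<open>r\<close> the first exponent of \<open>f\<close>. In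
  degree \<open>r + n\<close> all other products vanish in the tangent cone, so the product of the
  two lowest terms does too, and cancelling \<open>r\<close> copies of \<open>e\<close> contradicts
  the choice of \<open>n\<close>.\<close>

lemma param_regular:
  assumes "f \<noteq> 0" "P \<in> rees" "cls (param f * P) = cls 0"
  shows "cls P = cls 0"
proof (rule ccontr)
  assume "cls P \<noteq> cls 0"
  then have ex: "\<exists>n. Polynomial.coeff P n \<notin> filt B (Suc n)" using cls_eq_zero_iff[OF assms(2)] by blast
  define n where "n = (LEAST n. Polynomial.coeff P n \<notin> filt B (Suc n))"
  have n: "Polynomial.coeff P n \<notin> filt B (Suc n)" unfolding n_def using ex by (rule LeastI_ex)
  have nmin: "Polynomial.coeff P i \<in> filt B (Suc i)" if "i < n" for i
    using not_less_Least[of i] that unfolding n_def by blast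
  have ex': "\<exists>r. Polynomial.coeff f r \<noteq> 0" using assms(1) by (metis poly_eqI Polynomial.coeff_0)
  define r where "r = (LEAST r. Polynomial.coeff f r \<noteq> 0)"
  have r: "Polynomial.coeff f r \<noteq> 0" unfolding r_def using ex' by (rule LeastI_ex)
  have rmin: "Polynomial.coeff f i = 0" if "i < r" for i
    using not_less_Least[of i] that unfolding r_def by blast
  let ?t = "\<lambda>i. Polynomial.monom (Polynomial.coeff f i) (i * e) * Polynomial.coeff P (r + n - i)"
  have "Polynomial.coeff (param f * P) (r + n) \<in> filt B (Suc (r + n))"
    using assms(3) cls_eq_zero_iff[OF rees_mult[OF param_rees assms(2)]] by blast
  then have all: "(\<Sum>i\<le>r + n. ?t i) \<in> filt B (Suc (r + n))"
    by (simp add: Polynomial.coeff_mult coeff_param)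
  have remove: "(\<Sum>i\<le>r + n. ?t i) = ?t r + (\<Sum>i\<in>{..r + n} - {r}. ?t i)"
    by (rule sum.remove) auto
  have rest: "(\<Sum>i\<in>{..r + n} - {r}. ?t i) \<in> filt B (Suc (r + n))"
  proof (rule filt_sum)
    fix i assume i: "i \<in> {..r + n} - {r}"
    show "?t i \<in> filt B (Suc (r + n))"
    proof (cases "i < r")
      case True
      then show ?thesis by (simp add: rmin filt_zero)
    next
      case False
      \<comment> \<open>Here \<open>i > r\<close>, so the index \<open>r + n - i\<close> lies below
        \<open>n\<close>.\<close>
      then have "Polynomial.coeff P (r + n - i) \<in> filt B (Suc (r + n - i))" using i by (intro nmin) auto
      moreover have "Polynomial.monom (Polynomial.coeff f i) (i * e) \<in> filt B i"
        by (intro filt_monom level_mult e_in)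
      ultimately have "?t i \<in> filt B (i + Suc (r + n - i))" by (intro filt_mult)
      then show ?thesis using i by simp
    qed
  qed
  have "?t r \<in> filt B (Suc (r + n))" using filt_diff[OF all rest] by (simp only: remove add_diff_cancel_right')
  then have tr: "Polynomial.monom (Polynomial.coeff f r) (r * e) * Polynomial.coeff P n \<in> filt B (Suc (r + n))" by simp
  \<comment> \<open>Multiplication by a monomial only shifts exponents, so nothing cancels and each
    exponent can be treated alone.\<close>
  have "s \<in> level B (Suc n)" if s: "Polynomial.coeff (Polynomial.coeff P n) s \<noteq> 0" for s
  proof (rule level_cancel_mult)
    show "s \<in> submonoid_gen B" using rees_coeff'[OF assms(2), of n] s by (auto simp: filt_def level_0)
    have "Polynomial.coeff (Polynomial.monom (Polynomial.coeff f r) (r * e) * Polynomial.coeff P n) (s + r * e) \<noteq> 0"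
      using r s by (simp add: coeff_monom_mult)
    then have "s + r * e \<in> level B (Suc (r + n))" using tr by (simp add: filt_def)
    then show "s + r * e \<in> level B (Suc n + r)" by (simp add: add.commute)
  qed
  then show False using n by (simp add: filt_def)
qed

sublocale poly_algebra G "\<lambda>f. cls (param f)"
  by unfold_locales
    (simp_all add: cls_closed param_rees param_add param_mult param_1 cls_add cls_mult cls_1)

text \<open>The initial form of \<open>t ^ w\<close>: the \<open>SOME\<close> picks the order of
  \<open>w\<close>, which is unique because the levels decrease.\<close>

definition apery_class :: "nat \<Rightarrow> nat \<Rightarrow> 'k poly set" where
  "apery_class w = cls (Polynomial.monom (Polynomial.monom 1 w) (SOME n. w \<in> level B n \<and> w \<notin> level B (Suc n)))"

lemma apery_class:
  assumes "w \<in> level B n" "w \<notin> level B (Suc n)"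
  shows "apery_class w = cls (Polynomial.monom (Polynomial.monom 1 w) n)"
proof -
  have "(SOME n. w \<in> level B n \<and> w \<notin> level B (Suc n)) = n"
  proof (rule some_equality)
    fix l assume l: "w \<in> level B l \<and> w \<notin> level B (Suc l)"
    show "l = n" using l assms level_antimono[of "Suc l" n B] level_antimono[of "Suc n" l B]
      by (metis Suc_leI linorder_neqE_nat subsetD)
  qed (use assms in simp)
  then show ?thesis by (simp add: apery_class_def)
qed

lemma monom_rees: "s \<in> level B n \<Longrightarrow> Polynomial.monom (Polynomial.monom c s) n \<in> rees"
  by (intro rees_monom filt_monom)

lemma apery_class_nilpotent:
  assumes w: "w \<in> apery (submonoid_gen B) e" "w \<noteq> 0"
  shows "apery_class w \<in> G.nilradical"
proof -
  have "w \<in> submonoid_gen B" using w by (simp add: apery_def)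
  then obtain l where l: "w \<in> level B l" "w \<notin> level B (Suc l)" by (rule level_exact)
  let ?P = "Polynomial.monom (Polynomial.monom (1::'k) w) l"
  have P: "?P \<in> rees" using l(1) by (rule monom_rees)
  have "?P ^ e = Polynomial.monom (Polynomial.monom 1 (w * e)) (l * e)" by (simp add: monom_power)
  then have "cls (?P ^ e) = cls 0"
    using apery_mult_level[OF w l(1)] cls_pow[OF P, of e]
    by (subst cls_eq_zero_iff) (auto simp: filt_monom filt_zero)
  then have "cls ?P [^]\<^bsub>G\<^esub> e = \<zero>\<^bsub>G\<^esub>" using cls_pow[OF P, of e] by (simp add: cls_0)
  then show ?thesis
    using cls_closed[OF P] unfolding apery_class[OF l] G.nilradical_def by blast
qed

text \<open>If \<open>s\<close> has order above \<open>n\<close>, the class is zero. Otherwise write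
  \<open>s = w + k * e\<close> with \<open>w\<close> an Apery element; cancellation makes orders
  additive here, so \<open>n\<close> is \<open>k\<close> plus the order of \<open>w\<close>, and the
  class is a constant times \<open>x ^ k\<close> times the class of \<open>w\<close>.\<close>

lemma cls_monom_span:
  assumes s: "s \<in> level B n" and bs: "set bs = apery_class ` (apery (submonoid_gen B) e - {0})"
    and car: "set (\<one>\<^bsub>G\<^esub> # bs) \<subseteq> carrier G"
  shows "cls (Polynomial.monom (Polynomial.monom c s) n) \<in> span (\<one>\<^bsub>G\<^esub> # bs)"
proof -
  note S = submodule_span[OF car, unfolded submodule_def]
  show ?thesis
  proof (cases "s \<in> level B (Suc n)")
    case True
    then have "cls (Polynomial.monom (Polynomial.monom c s) n) = cls 0"
      by (subst cls_eq_zero_iff) (auto simp: filt_monom filt_zero s monom_rees)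
    then show ?thesis using S by (simp add: cls_0)
  next
    case False
    have "s \<in> submonoid_gen B" using s level_antimono[of 0 n B] level_0 by auto
    then obtain w k where w: "w \<in> apery (submonoid_gen B) e" "s = w + k * e"
      using apery_decompose by blast
    then have wH: "w \<in> submonoid_gen B" by (simp add: apery_def)
    then obtain l where l: "w \<in> level B l" "w \<notin> level B (Suc l)" by (rule level_exact)
    have "s \<in> level B (l + k)" unfolding w(2) by (intro level_add level_mult e_in l(1))
    then have "l + k \<le> n" using False level_antimono[of "Suc n" "l + k" B]
      by (metis not_less_eq_eq subsetD)
    moreover have "\<not> Suc l + k \<le> n"
    proof
      assume "Suc l + k \<le> n"
      then have "w + k * e \<in> level B (Suc l + k)" using s w(2) level_antimono by blast
      then have "w \<in> level B (Suc l)" by (rule level_cancel_mult[OF wH])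
      with l show False by simp
    qed
    ultimately have n: "n = k + l" by simp
    have "apery_class w \<in> span (\<one>\<^bsub>G\<^esub> # bs)"
    proof (rule span_mem[OF car])
      show "apery_class w \<in> set (\<one>\<^bsub>G\<^esub> # bs)"
      \<comment> \<open>The Apery element \<open>0\<close> gives the unit, listed apart from the
        nilpotent \<open>bs\<close>.\<close>
      proof (cases "w = 0")
        case True
        have "l = 0" using level_ge[OF l(1)] True e_pos by simp
        then have "apery_class w = cls 1" unfolding apery_class[OF l] by (simp add: True monom_0 flip: one_pCons)
        then show ?thesis by (simp add: cls_1)
      next
        case False
        then show ?thesis using w bs by simp
      qed
    qed
    moreover have "cls (Polynomial.monom (Polynomial.monom c s) n)
      = cls (param (Polynomial.monom c k)) \<otimes>\<^bsub>G\<^esub> apery_class w"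
      using cls_mult[OF param_rees[of "Polynomial.monom c k"] monom_rees[OF l(1), of 1]]
      by (simp add: apery_class[OF l] param_monom mult_monom n w(2) add.commute)
    ultimately show ?thesis using S by simp
  qed
qed

lemma carrier_span_G:
  assumes bs: "set bs = apery_class ` (apery (submonoid_gen B) e - {0})"
    and car: "set (\<one>\<^bsub>G\<^esub> # bs) \<subseteq> carrier G"
  shows "carrier G = span (\<one>\<^bsub>G\<^esub> # bs)"
proof
  note S = submodule_span[OF car, unfolded submodule_def]
  show "span (\<one>\<^bsub>G\<^esub> # bs) \<subseteq> carrier G" using S by blast
  \<comment> \<open>Membership in \<open>rees\<close> is carried along because
    \<open>cls_add\<close> requires it of both summands.\<close>
  define Q where "Q = (\<lambda>P. P \<in> rees \<and> cls P \<in> span (\<one>\<^bsub>G\<^esub> # bs))"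
  have Q0: "Q 0" using S by (simp add: Q_def rees_zero flip: cls_0)
  have Qadd: "Q (P + P')" if "Q P" "Q P'" for P P'
    using that S cls_add[of P P'] unfolding Q_def by (metis rees_add)
  have Qmonom: "Q (Polynomial.monom p n)" if "p \<in> filt B n" for p n
    using that
  proof (induction rule: filt_induct)
    case zero
    then show ?case using Q0 by simp
  next
    case (add p q)
    then show ?case using Qadd by (simp flip: add_monom)
  next
    case (monom c s)
    then show ?case unfolding Q_def using cls_monom_span[OF _ bs car] monom_rees by blast
  qed
  have "Q P" if "P \<in> rees" for P
  proof -
    have "Q (\<Sum>i\<le>Polynomial.degree P. Polynomial.monom (Polynomial.coeff P i) i)"
      by (rule sum_closed_induct[of Q]) (use Q0 Qadd Qmonom rees_coeff[OF that] in auto)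
    then show ?thesis by (simp only: poly_as_sum_of_monoms)
  qed
  then show "carrier G \<subseteq> span (\<one>\<^bsub>G\<^esub> # bs)" unfolding carrier_G Q_def by blast
qed

lemma cohen_macaulay_tangent_cone: "cohen_macaulay G"
proof -
  obtain bs where bs: "set bs = apery_class ` (apery (submonoid_gen B) e - {0})"
    using finite_list[of "apery_class ` (apery (submonoid_gen B) e - {0})"] apery_finite by auto
  have nil: "set bs \<subseteq> G.nilradical" using bs apery_class_nilpotent by auto
  then have car: "set (\<one>\<^bsub>G\<^esub> # bs) \<subseteq> carrier G" by (auto simp: G.nilradical_def)
  have "nilpotent_extension G (\<lambda>f. cls (param f)) bs"
  proof
    show "set bs \<subseteq> G.nilradical" by (fact nil)
    show "carrier G = span (\<one>\<^bsub>G\<^esub> # bs)" using bs car by (rule carrier_span_G)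
    fix f r assume "f \<noteq> 0" "r \<in> carrier G" "cls (param f) \<otimes>\<^bsub>G\<^esub> r = \<zero>\<^bsub>G\<^esub>"
    then show "r = \<zero>\<^bsub>G\<^esub>" using param_regular
      by (auto simp: carrier_G cls_0 cls_mult param_rees)
  qed
  then show ?thesis by (rule nilpotent_extension.cohen_macaulay)
qed

end

theorem corollary6p4:
  fixes d :: nat and n m :: "nat \<Rightarrow> nat" and g c j :: nat and T H :: "nat set" and L :: real
  assumes "d \<ge> 2"
    and "\<And>i. i \<in> {1..d} \<Longrightarrow> n i > 0"
    and "strict_mono_on {1..d} n"
    and "\<And>i. i \<in> {1..d} \<Longrightarrow> m i = n d - n i"
    and "g = Gcd (m ` {1..d - 1})"
    and "T = submonoid_gen ((\<lambda>i. m i div g) ` {1..d - 1})"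
    and "c = conductor T"
    and "L = real (m 1) * real (m 2) * ((real g * real c + real (m 1)) / real (m (d - 1)) + real d)
             - real (n d)"
    and "real j > L"
    and "H = submonoid_gen ((\<lambda>i. n i + j) ` {1..d})"
  shows "homogeneous H \<and> cohen_macaulay (tangent_cone TYPE('k::field) H)"
proof -
  have "minimal_generators (min_gens H) H"
    using assms(10) min_gens_minimal_generators by metis
  then have H: "submonoid_gen (min_gens H) = H" by (simp add: minimal_generators_def)
  interpret exchange_semigroup "min_gens H" "n 1 + j" by (rule exchange_semigroup_shift[OF assms])
  interpret tangent_semigroup "min_gens H" "n 1 + j" "TYPE('k)" by unfold_locales (simp add: H)
  show ?thesis using homogeneous min_gens cohen_macaulay_tangent_cone unfolding H by simp
qed

end
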